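(* $\mathrm{L}\cap\mathrm{CFL}(2)/n\nsubseteq\mathrm{CFL}/n$. Thus, $\mathrm{CFL}(2)\nsubseteq\mathrm{CFL}/n$.
   Context: $\mathrm{L}$ is the family of languages recognized by deterministic two-way off-line Turing machines in logarithmic work space. CFL is the family of context-free languages, and $\mathrm{CFL}(2)$ is the family of languages expressible as the intersection of two context-free languages. For strings $x=x_1\cdots x_n\in\Sigma^n$, $y=y_1\cdots y_n\in\Gamma^n$ of equal length, $[\begin{smallmatrix} x \\ y \end{smallmatrix}]$ denotes the string $[\begin{smallmatrix} x_1 \\ y_1 \end{smallmatrix}]\cdots[\begin{smallmatrix} x_n \\ y_n \end{smallmatrix}]$ over the alphabet of pairs $\Sigma\times\Gamma$. For a language family $\mathcal{C}$, a language $L$ over an alphabet $\Sigma$ is in $\mathcal{C}/n$ if there are an alphabet $\Gamma$, a function $h:\mathbb{N}\to\Gamma^*$ with $|h(n)|=n$ for all $n$ (an arbitrary length-preserving advice function), and a language $S\in\mathcal{C}$ over the pair alphabet such that for all $x\in\Sigma^*$: $x\in L\iff[\begin{smallmatrix} x \\ h(|x|) \end{smallmatrix}]\in S$. $\mathrm{L}\cap\mathrm{CFL}(2)/n$ means the intersection of the two families $\mathrm{L}$ and $\mathrm{CFL}(2)/n$. *)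

theory Defs
  imports Complex_Main "HOL-Library.Landau_Symbols"
begin

text \<open>
  A language family is a set of languages, each of which is a set of words over some finite
  alphabet, where alphabets are finite sets of elements of a type of symbols. The definitions are
  polymorphic in that type, because advice turns a language over \<open>'a\<close> into one over
  \<open>'a \<times> nat\<close>. An arbitrary finite alphabet can be encoded only if the type is infinite, so
  the type \<open>nat\<close> is used for input symbols, advice symbols, nonterminals, states and work
  tape symbols.
\<close>

datatype ('n, 't) gsym = Nt 'n | Tm 't

type_synonym ('n, 't) prods = "('n \<times> ('n, 't) gsym list) set"

inductive derive1 :: "('n, 't) prods \<Rightarrow> ('n, 't) gsym list \<Rightarrow> ('n, 't) gsym list \<Rightarrow> bool"
  for P where
  "(A, \<alpha>) \<in> P \<Longrightarrow> derive1 P (u @ [Nt A] @ v) (u @ \<alpha> @ v)"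

definition gen_lang :: "('n, 't) prods \<Rightarrow> 'n \<Rightarrow> 't list set" where
  "gen_lang P S = {w. (derive1 P)\<^sup>*\<^sup>* [Nt S] (map Tm w)}"

text \<open>
  A grammar is given by its productions and its start symbol. Since there are finitely many
  productions, finitely many nonterminals and terminals matter, so every language below is a
  language over a finite alphabet even when the type \<open>'t\<close> is infinite.
\<close>

definition CFL :: "'t list set set" where
  "CFL = {gen_lang P S |(P :: (nat, 't) prods) S. finite P}"

definition CFL2 :: "'t list set set" where
  "CFL2 = {A \<inter> B |A B. A \<in> CFL \<and> B \<in> CFL}"

text \<open>
  \<open>with_advice \<C>\<close> is the family $\mathcal{C}/n$. For words of equal length,
  \<open>zip x y\<close> is the word of pairs with upper track \<open>x\<close> and lower track \<open>y\<close>.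
\<close>

definition with_advice :: "('a \<times> nat) list set set \<Rightarrow> 'a list set set" where
  "with_advice \<C> = {L. \<exists>\<Sigma> \<Gamma> h S.
     finite \<Sigma> \<and> L \<subseteq> lists \<Sigma> \<and> finite \<Gamma> \<and>
     (\<forall>n. h n \<in> lists \<Gamma> \<and> length (h n) = n) \<and>
     S \<in> \<C> \<and> S \<subseteq> lists (\<Sigma> \<times> \<Gamma>) \<and>
     (\<forall>x \<in> lists \<Sigma>. x \<in> L \<longleftrightarrow> zip x (h (length x)) \<in> S)}"

text \<open>
  Deterministic off-line Turing machines: a two-way read-only input tape delimited by endmarkers,
  and one semi-infinite read/write work tape, initially blank.
\<close>

datatype 'a insym = LeftEnd | Input 'a | RightEnd

datatype dir = GoLeft | Stay | GoRight

record 'a otm =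
  in_alph :: "'a set"
  states :: "nat set"
  work_alph :: "nat set"
  blank :: nat
  start :: nat
  accept :: nat
  reject :: nat
  delta :: "nat \<Rightarrow> 'a insym \<Rightarrow> nat \<Rightarrow> nat \<times> dir \<times> nat \<times> dir"
    \<comment> \<open>state, scanned input symbol, scanned work symbol
        to new state, input head move, written work symbol, work head move\<close>

definition wf_otm :: "'a otm \<Rightarrow> bool" where
  "wf_otm M \<longleftrightarrow>
     finite (in_alph M) \<and> finite (states M) \<and> finite (work_alph M) \<and>
     blank M \<in> work_alph M \<and>
     start M \<in> states M \<and> accept M \<in> states M \<and> reject M \<in> states M \<and>
     accept M \<noteq> reject M \<and>
     (\<forall>q \<in> states M. \<forall>a \<in> {LeftEnd, RightEnd} \<union> Input ` in_alph M. \<forall>b \<in> work_alph M.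
        case delta M q a b of (q', d, b', e) \<Rightarrow>
          q' \<in> states M \<and> b' \<in> work_alph M \<and>
          (a = LeftEnd \<longrightarrow> d \<noteq> GoLeft) \<and> (a = RightEnd \<longrightarrow> d \<noteq> GoRight))"

record config =
  cstate :: nat
  in_pos :: nat
  work_tape :: "nat \<Rightarrow> nat"
  work_pos :: nat

definition input_at :: "'a list \<Rightarrow> nat \<Rightarrow> 'a insym" where
  "input_at x i =
     (if i = 0 then LeftEnd else if i \<le> length x then Input (x ! (i - 1)) else RightEnd)"

text \<open>
  A left move from work cell 0 leaves the head there. The input head cannot leave the endmarkers,
  by \<open>wf_otm\<close>.
\<close>

fun move :: "dir \<Rightarrow> nat \<Rightarrow> nat" where
  "move GoLeft i = i - 1"
| "move Stay i = i"
| "move GoRight i = i + 1"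

definition init :: "'a otm \<Rightarrow> config" where
  "init M = \<lparr>cstate = start M, in_pos = 0, work_tape = (\<lambda>_. blank M), work_pos = 0\<rparr>"

text \<open>Halting configurations are fixed points of the step function.\<close>

definition step :: "'a otm \<Rightarrow> 'a list \<Rightarrow> config \<Rightarrow> config" where
  "step M x c =
     (if cstate c \<in> {accept M, reject M} then c
      else case delta M (cstate c) (input_at x (in_pos c)) (work_tape c (work_pos c)) of
        (q, d, b, e) \<Rightarrow>
          \<lparr>cstate = q,
           in_pos = move d (in_pos c),
           work_tape = (work_tape c)(work_pos c := b),
           work_pos = move e (work_pos c)\<rparr>)"

definition config_at :: "'a otm \<Rightarrow> 'a list \<Rightarrow> nat \<Rightarrow> config" where
  "config_at M x t = (step M x ^^ t) (init M)"

definition accepts :: "'a otm \<Rightarrow> 'a list \<Rightarrow> bool" where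
  "accepts M x \<longleftrightarrow> (\<exists>t. cstate (config_at M x t) = accept M)"

definition rejects :: "'a otm \<Rightarrow> 'a list \<Rightarrow> bool" where
  "rejects M x \<longleftrightarrow> (\<exists>t. cstate (config_at M x t) = reject M)"

definition recognizes :: "'a otm \<Rightarrow> 'a list set \<Rightarrow> bool" where
  "recognizes M L \<longleftrightarrow> L \<subseteq> lists (in_alph M) \<and>
     (\<forall>x \<in> lists (in_alph M). (x \<in> L \<longrightarrow> accepts M x) \<and> (x \<notin> L \<longrightarrow> rejects M x))"

text \<open>Only work cells count: the first \<open>s n\<close> cells suffice on every input of length \<open>n\<close>.\<close>

definition runs_in_space :: "'a otm \<Rightarrow> (nat \<Rightarrow> nat) \<Rightarrow> bool" where
  "runs_in_space M s \<longleftrightarrow>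
     (\<forall>x \<in> lists (in_alph M). \<forall>t. work_pos (config_at M x t) < s (length x))"

definition LOGSPACE :: "'a list set set" where
  "LOGSPACE = {L. \<exists>M s. wf_otm M \<and> recognizes M L \<and> runs_in_space M s \<and>
     (\<lambda>n. real (s n)) \<in> O(\<lambda>n. ln (real n))}"

end

theory Submission
  imports Defs "HOL-Library.Countable" "HOL-Library.Log_Nat"
begin

text \<open>
  The witness is the language of words over \<open>{0, 1, 2, 3}\<close> whose subwords of letters in \<open>{0, 1}\<close> and
  of letters in \<open>{2, 3}\<close> are both palindromes. Either condition is context-free, and one counter,
  kept in binary, suffices to compare the letters of a subword pairwise.

  Suppose the language is in CFL/n. In a parse tree of a long word with its advice some node has a
  yield of length between \<open>n / r\<close> and \<open>n\<close>, and words of equal length that share the nonterminal and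
  the position of such a node can exchange the parts below it. There are only polynomially many such
  types. For the words \<open>x y rev(x) rev(y)\<close> with four blocks of length \<open>n\<close>, a factor of length at most
  \<open>n\<close> contains no two matched positions, so the exchange stays in the language only if the exchanged
  factors are equal. But if \<open>x\<close> and \<open>y\<close> repeat a binary word \<open>u\<close> of length \<open>l\<close>, a factor longer than
  \<open>2 l\<close> determines \<open>u\<close>, and there are \<open>2\<^sup>l\<close> choices of \<open>u\<close>.
\<close>

section \<open>Parse trees\<close>

text \<open>A parse tree is represented only by its root symbol and its yield. The children enter as
  a list of yields, so replacing the yield of one child is a single application of
  \<open>yields_Nt\<close>.\<close>

inductive yields :: "('n, 't) prods \<Rightarrow> ('n, 't) gsym \<Rightarrow> 't list \<Rightarrow> bool" for P where
  yields_Tm: "yields P (Tm a) [a]"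
| yields_Nt: "(A, \<alpha>) \<in> P \<Longrightarrow> list_all2 (yields P) \<alpha> ws \<Longrightarrow> yields P (Nt A) (concat ws)"

lemma derives_context:
  assumes "(derive1 P)\<^sup>*\<^sup>* \<alpha> \<beta>"
  shows "(derive1 P)\<^sup>*\<^sup>* (u @ \<alpha> @ v) (u @ \<beta> @ v)"
  using assms
proof (induction rule: rtranclp_induct)
  case base
  show ?case by simp
next
  case (step \<beta> \<gamma>)
  obtain A a b \<delta> where "(A, \<delta>) \<in> P" "\<beta> = a @ [Nt A] @ b" "\<gamma> = a @ \<delta> @ b"
    using step.hyps(2) by (auto elim: derive1.cases)
  then have "derive1 P (u @ \<beta> @ v) (u @ \<gamma> @ v)"
    using derive1.intros[of A \<delta> P "u @ a" "b @ v"] by simp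
  with step.IH show ?case by simp
qed

lemma derives_concat:
  assumes "list_all2 (\<lambda>s w. (derive1 P)\<^sup>*\<^sup>* [s] (map Tm w)) \<alpha> ws"
  shows "(derive1 P)\<^sup>*\<^sup>* \<alpha> (map Tm (concat ws))"
  using assms
proof (induction rule: list_all2_induct)
  case Nil
  show ?case by simp
next
  case (Cons s \<alpha> w ws)
  have "(derive1 P)\<^sup>*\<^sup>* ([s] @ \<alpha>) (map Tm w @ \<alpha>)"
    using derives_context[OF Cons.hyps(1), of "[]" \<alpha>] by simp
  also have "(derive1 P)\<^sup>*\<^sup>* (map Tm w @ \<alpha>) (map Tm w @ map Tm (concat ws))"
    using derives_context[OF Cons.IH, of "map Tm w" "[]"] by simp
  finally show ?case by simp
qed

lemma yields_imp_derives: "yields P s w \<Longrightarrow> (derive1 P)\<^sup>*\<^sup>* [s] (map Tm w)"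
proof (induction rule: yields.induct)
  case (yields_Tm a)
  show ?case by simp
next
  case (yields_Nt A \<alpha> ws)
  have "(derive1 P)\<^sup>*\<^sup>* \<alpha> (map Tm (concat ws))"
    by (rule derives_concat, rule list_all2_mono[OF yields_Nt(2)]) simp
  moreover have "derive1 P [Nt A] \<alpha>"
    using derive1.intros[OF yields_Nt(1), of "[]" "[]"] by simp
  ultimately show ?case by (rule converse_rtranclp_into_rtranclp[rotated])
qed

text \<open>Induction on the derivation from its front: the trees below a right-hand side introduced
  by the first step are gathered under one new node for the rewritten nonterminal.\<close>

lemma derives_imp_yields:
  assumes "(derive1 P)\<^sup>*\<^sup>* \<alpha> (map Tm w)"
  shows "\<exists>ws. list_all2 (yields P) \<alpha> ws \<and> w = concat ws"
  using assms
proof (induction rule: converse_rtranclp_induct)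
  case base
  have "list_all2 (yields P) (map Tm w) (map (\<lambda>a. [a]) w)"
    by (simp add: list_all2_map1 list_all2_map2 list.rel_refl yields_Tm)
  then show ?case by (intro exI[of _ "map (\<lambda>a. [a]) w"]) simp
next
  case (step \<alpha> \<beta>)
  obtain A u v \<gamma> where *: "(A, \<gamma>) \<in> P" "\<alpha> = u @ [Nt A] @ v" "\<beta> = u @ \<gamma> @ v"
    using step.hyps(1) by (auto elim: derive1.cases)
  obtain wu wg wv where "list_all2 (yields P) u wu" "list_all2 (yields P) \<gamma> wg"
    "list_all2 (yields P) v wv" "w = concat (wu @ wg @ wv)"
    using step.IH unfolding *(3) by (auto simp: list_all2_append1)
  then have "list_all2 (yields P) \<alpha> (wu @ [concat wg] @ wv)" "w = concat (wu @ [concat wg] @ wv)"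
    unfolding *(2) using yields_Nt[OF *(1)] by (auto intro!: list_all2_appendI)
  then show ?case by blast
qed

lemma gen_lang_eq_yields: "gen_lang P S = {w. yields P (Nt S) w}"
  unfolding gen_lang_def using derives_imp_yields[of P "[Nt S]"] yields_imp_derives[of P "Nt S"]
  by (fastforce simp: list_all2_Cons1)

lemma length_concat_le:
  assumes "\<And>w. w \<in> set ws \<Longrightarrow> r * length w \<le> M"
  shows "r * length (concat ws) \<le> length ws * M"
  using assms by (induction ws) (auto simp: algebra_simps add_mono)

text \<open>Descend from the root to a child of maximal yield until the yield has length at most \<open>M\<close>.\<close>

lemma yields_midsize:
  assumes "yields P s w" and rhs: "\<And>A \<alpha>. (A, \<alpha>) \<in> P \<Longrightarrow> length \<alpha> \<le> r"
    and "1 \<le> r" "r \<le> M" "M < length w"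
  shows "\<exists>B u w' v. B \<in> fst ` P \<and> w = u @ w' @ v \<and> yields P (Nt B) w' \<and>
    length w' \<le> M \<and> M < r * length w' \<and>
    (\<forall>z. yields P (Nt B) z \<longrightarrow> yields P s (u @ z @ v))"
  using assms(1,5)
proof (induction rule: yields.induct)
  case (yields_Tm a)
  then show ?case using assms(3,4) by simp
next
  case (yields_Nt A \<alpha> ws)
  have len: "length ws = length \<alpha>" using yields_Nt(2) by (simp add: list_all2_lengthD)
  \<comment> \<open>At most \<open>r\<close> children share more than \<open>M\<close> letters, so
    one of them yields more than \<open>M / r\<close>.\<close>
  have "\<exists>w \<in> set ws. M < r * length w"
  proof (rule ccontr)
    assume "\<not> ?thesis"
    then have "r * length (concat ws) \<le> length ws * M"
      by (intro length_concat_le) (auto simp: not_less)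
    also have "\<dots> \<le> r * M" using rhs[OF yields_Nt(1)] len by simp
    finally show False using yields_Nt.prems assms(3) by simp
  qed
  then obtain ws1 w ws2 where ws: "ws = ws1 @ w # ws2" and w: "M < r * length w"
    by (metis split_list)
  \<comment> \<open>\<open>Q\<close> joins the premise on a child with its induction hypothesis, so
    that both survive splitting the list at the chosen child.\<close>
  define Q where "Q = (\<lambda>s w. yields P s w \<and>
    (M < length w \<longrightarrow> (\<exists>B u w' v. B \<in> fst ` P \<and> w = u @ w' @ v \<and> yields P (Nt B) w' \<and>
      length w' \<le> M \<and> M < r * length w' \<and>
      (\<forall>z. yields P (Nt B) z \<longrightarrow> yields P s (u @ z @ v)))))"
  have "list_all2 Q \<alpha> (ws1 @ w # ws2)"
    using yields_Nt(2) unfolding ws Q_def .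
  then obtain \<alpha>1 s \<alpha>2 where \<alpha>: "\<alpha> = \<alpha>1 @ s # \<alpha>2"
    and Q: "list_all2 Q \<alpha>1 ws1" "list_all2 Q \<alpha>2 ws2" "Q s w"
    by (auto simp: list_all2_append2 list_all2_Cons2)
  have 1: "list_all2 (yields P) \<alpha>1 ws1" and 2: "list_all2 (yields P) \<alpha>2 ws2"
    by (rule list_all2_mono[OF Q(1)] list_all2_mono[OF Q(2)]; simp add: Q_def)+
  have s: "yields P s w" using Q(3) by (simp add: Q_def)
  have repl: "yields P (Nt A) (concat ws1 @ z @ concat ws2)" if "yields P s z" for z
    using yields.yields_Nt[OF yields_Nt(1), of "ws1 @ z # ws2"] 1 2 that
    unfolding \<alpha> by (auto intro!: list_all2_appendI)
  show ?case
  proof (cases "length w \<le> M")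
    case True
    \<comment> \<open>A terminal is excluded: its yield has length 1, against
      \<open>M < r * length w\<close> and \<open>r \<le> M\<close>.\<close>
    obtain B where B: "s = Nt B" "B \<in> fst ` P"
      using s by (cases rule: yields.cases) (use w assms(4) in force)+
    have "concat ws = concat ws1 @ w @ concat ws2" by (simp add: ws)
    then show ?thesis using B s w True repl by blast
  next
    case False
    then obtain B u w' v where *: "B \<in> fst ` P" "w = u @ w' @ v" "yields P (Nt B) w'"
      "length w' \<le> M" "M < r * length w'" "\<forall>z. yields P (Nt B) z \<longrightarrow> yields P s (u @ z @ v)"
      using Q(3) unfolding Q_def not_le by blast
    have "concat ws = (concat ws1 @ u) @ w' @ v @ concat ws2" using *(2) by (simp add: ws)
    moreover have "\<forall>z. yields P (Nt B) z \<longrightarrow> yields P (Nt A) ((concat ws1 @ u) @ z @ v @ concat ws2)"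
      using *(6) repl by fastforce
    ultimately show ?thesis using *(1,3,4,5) by blast
  qed
qed

section \<open>A grammar for words with a palindromic subword\<close>

text \<open>One nonterminal suffices. Letters of \<open>K\<close> arise in equal pairs from the
  outside inwards, with at most one in the middle; letters of \<open>D\<close> may be added at
  either end at any time, because the filter does not see them.\<close>

lemma filter_palindrome_CFL:
  fixes K D :: "'t set"
  assumes "finite K" "finite D" "K \<inter> D = {}"
  shows "{w \<in> lists (K \<union> D). rev (filter (\<lambda>a. a \<in> K) w) = filter (\<lambda>a. a \<in> K) w} \<in> CFL"
    (is "?L \<in> CFL")
proof -
  define P :: "(nat, 't) prods" where
    "P = {(0, [])} \<union> (\<lambda>a. (0, [Tm a])) ` K \<union> (\<lambda>a. (0, [Tm a, Nt 0, Tm a])) ` K \<union>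
         (\<lambda>a. (0, [Tm a, Nt 0])) ` D \<union> (\<lambda>a. (0, [Nt 0, Tm a])) ` D"
  have mem: "(0, []) \<in> P" "a \<in> K \<Longrightarrow> (0, [Tm a]) \<in> P" "a \<in> K \<Longrightarrow> (0, [Tm a, Nt 0, Tm a]) \<in> P"
    "a \<in> D \<Longrightarrow> (0, [Tm a, Nt 0]) \<in> P" "a \<in> D \<Longrightarrow> (0, [Nt 0, Tm a]) \<in> P" for a
    by (auto simp: P_def)
  have Tm: "yields P (Tm a) w \<longleftrightarrow> w = [a]" for a w
    by (auto elim: yields.cases intro: yields_Tm)
  have disj: False if "a \<in> K" "a \<in> D" for a
    using that assms(3) by blast
  have sound: "s = Nt 0 \<longrightarrow> w \<in> ?L" if "yields P s w" for s w
    using that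
  proof (induction rule: yields.induct)
    case (yields_Nt A \<alpha> ws)
    have "list_all2 (yields P) \<alpha> ws"
      by (rule list_all2_mono[OF yields_Nt(2)]) simp
    moreover have "\<alpha> = [] \<or> (\<exists>a \<in> K. \<alpha> = [Tm a] \<or> \<alpha> = [Tm a, Nt 0, Tm a]) \<or>
        (\<exists>a \<in> D. \<alpha> = [Tm a, Nt 0] \<or> \<alpha> = [Nt 0, Tm a])"
      using yields_Nt(1) by (auto simp: P_def)
    ultimately show ?case using yields_Nt(2) assms(3)
      by (elim disjE bexE; simp add: list_all2_Cons1 Tm; use disj in fastforce)
  qed simp
  have complete: "yields P (Nt 0) w" if "w \<in> ?L" for w
    using that
  proof (induction w rule: length_induct)
    case (1 w)
    have sub: "set w \<subseteq> K \<union> D" and pal: "rev (filter (\<lambda>a. a \<in> K) w) = filter (\<lambda>a. a \<in> K) w"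
      using 1(2) by auto
    have IH: "yields P (Nt 0) v" if "length v < length w" "set v \<subseteq> K \<union> D"
      "rev (filter (\<lambda>a. a \<in> K) v) = filter (\<lambda>a. a \<in> K) v" for v
      using that by (intro 1(1)[rule_format]) auto
    have eps: "yields P (Nt 0) []"
      using yields_Nt[of 0 "[]" P "[]"] mem by simp
    have one: "yields P (Nt 0) [a]" if "a \<in> K" for a
      using yields_Nt[of 0 "[Tm a]" P "[[a]]"] that mem by (simp add: Tm)
    have two: "yields P (Nt 0) (a # v @ [a])" if "a \<in> K" "yields P (Nt 0) v" for a v
      using yields_Nt[of 0 "[Tm a, Nt 0, Tm a]" P "[[a], v, [a]]"] that mem by (simp add: Tm)
    have left: "yields P (Nt 0) (a # v)" if "a \<in> D" "yields P (Nt 0) v" for a v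
      using yields_Nt[of 0 "[Tm a, Nt 0]" P "[[a], v]"] that mem by (simp add: Tm)
    have right: "yields P (Nt 0) (v @ [a])" if "a \<in> D" "yields P (Nt 0) v" for a v
      using yields_Nt[of 0 "[Nt 0, Tm a]" P "[v, [a]]"] that mem by (simp add: Tm)
    consider "w = []" | a where "w = [a]" | a v b where "w = a # v @ [b]"
      by (metis append_butlast_last_id neq_Nil_conv)
    then show ?case
    proof cases
      case 3
      show ?thesis
      proof (cases "a \<in> D \<or> b \<in> D")
        case True
        then show ?thesis
        proof
          assume a: "a \<in> D"
          then have "filter (\<lambda>a. a \<in> K) (v @ [b]) = filter (\<lambda>a. a \<in> K) w" using disj 3 by auto
          then have "yields P (Nt 0) (v @ [b])"
            by (intro IH) (simp_all only: pal, use sub 3 in auto)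
          then show ?thesis using left[OF a] 3 by simp
        next
          assume b: "b \<in> D"
          then have "filter (\<lambda>a. a \<in> K) (a # v) = filter (\<lambda>a. a \<in> K) w" using disj 3 by auto
          then have "yields P (Nt 0) (a # v)"
            by (intro IH) (simp_all only: pal, use sub 3 in auto)
          then show ?thesis using right[OF b, of "a # v"] 3 by simp
        qed
      next
        case False
        then have K: "a \<in> K" "b \<in> K" using sub by (auto simp: 3)
        \<comment> \<open>With no letter of \<open>D\<close> to peel off, both end letters belong to
          the filtered palindrome and must agree.\<close>
        then have "hd (rev (filter (\<lambda>a. a \<in> K) w)) = b" "hd (filter (\<lambda>a. a \<in> K) w) = a"
          by (simp_all add: 3)
        then have ab: "a = b" using pal by simp
        have "rev (filter (\<lambda>a. a \<in> K) v) = filter (\<lambda>a. a \<in> K) v"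
          using pal K by (simp add: 3 ab)
        then have "yields P (Nt 0) v"
          using sub by (intro IH) (auto simp: 3)
        then show ?thesis using two[OF K(1)] 3 ab by simp
      qed
    next
      case 2
      then have "a \<in> K \<or> a \<in> D" using sub by simp
      then show ?thesis using 2 one left[OF _ eps] by blast
    qed (use eps in simp)
  qed
  have "finite P" unfolding P_def using assms by simp
  moreover have "?L = gen_lang P 0"
    unfolding gen_lang_eq_yields using sound complete by blast
  ultimately show ?thesis unfolding CFL_def by blast
qed

section \<open>The lower bound\<close>

text \<open>Words of equal length carry equal advice, so the advice track survives the exchange.\<close>

lemma advised_CFL_swap:
  assumes "L \<in> with_advice CFL"
  obtains m r where "1 \<le> r"
    "\<And>N M U. \<lbrakk>U \<subseteq> L; \<And>x. x \<in> U \<Longrightarrow> length x = N; r \<le> M; M < N; m * (N + 1)^2 < card U\<rbrakk> \<Longrightarrow>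
      \<exists>x \<in> U. \<exists>y \<in> U. \<exists>i j. x \<noteq> y \<and> i + j \<le> N \<and> j \<le> M \<and> M < r * j \<and>
        take i x @ take j (drop i y) @ drop (i + j) x \<in> L"
proof -
  obtain \<Sigma> :: "'a set" and \<Gamma> S and h :: "nat \<Rightarrow> nat list" where *: "finite \<Sigma> \<and> L \<subseteq> lists \<Sigma> \<and> finite \<Gamma> \<and>
     (\<forall>n. h n \<in> lists \<Gamma> \<and> length (h n) = n) \<and>
     S \<in> CFL \<and> S \<subseteq> lists (\<Sigma> \<times> \<Gamma>) \<and>
     (\<forall>x \<in> lists \<Sigma>. x \<in> L \<longleftrightarrow> zip x (h (length x)) \<in> S)"
    using assms unfolding with_advice_def mem_Collect_eq by (elim exE)
  then have L: "L \<subseteq> lists \<Sigma>" and h: "length (h n) = n" and S: "S \<in> CFL"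
    and LS: "x \<in> lists \<Sigma> \<Longrightarrow> x \<in> L \<longleftrightarrow> zip x (h (length x)) \<in> S" for x n
    by blast+
  obtain P :: "(nat, 'a \<times> nat) prods" and s where fin: "finite P" and SP: "S = gen_lang P s"
    using S unfolding CFL_def by auto
  \<comment> \<open>\<open>r\<close> bounds every right-hand side; the successor makes it positive
    for every grammar.\<close>
  define r where "r = Suc (\<Sum>p\<in>P. length (snd p))"
  define m where "m = card (fst ` P)"
  have rhs: "length \<alpha> \<le> r" if "(A, \<alpha>) \<in> P" for A \<alpha>
    using member_le_sum[OF that, of "\<lambda>p. length (snd p)"] fin by (simp add: r_def)
  show thesis
  proof (rule that[of r m])
    show "1 \<le> r" by (simp add: r_def)
    fix N M :: nat and U
    assume UL: "U \<subseteq> L" and len: "\<And>x. x \<in> U \<Longrightarrow> length x = N" and "r \<le> M" "M < N"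
      and card: "m * (N + 1)^2 < card U"
    \<comment> \<open>\<open>Q x B i j\<close> makes \<open>(B, i, j)\<close> a type of
      \<open>x\<close>: nonterminal, offset and length of a midsize node in a parse tree of
      \<open>x\<close> with its advice.\<close>
    define Q where "Q x B i j \<longleftrightarrow> (\<exists>u w v. B \<in> fst ` P \<and> zip x (h N) = u @ w @ v \<and>
      length u = i \<and> length w = j \<and> yields P (Nt B) w \<and> j \<le> M \<and> M < r * j \<and>
      (\<forall>z. yields P (Nt B) z \<longrightarrow> u @ z @ v \<in> S))" for x B i j
    have "\<exists>t. Q x (fst t) (fst (snd t)) (snd (snd t))" if xU: "x \<in> U" for x
    proof -
      have "zip x (h N) \<in> S" using xU UL L LS len by blast
      then have "yields P (Nt s) (zip x (h N))" by (simp add: SP gen_lang_eq_yields)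
      moreover have "M < length (zip x (h N))" using \<open>M < N\<close> h len[OF xU] by simp
      ultimately have "\<exists>B u w v. B \<in> fst ` P \<and> zip x (h N) = u @ w @ v \<and> yields P (Nt B) w \<and>
          length w \<le> M \<and> M < r * length w \<and>
          (\<forall>z. yields P (Nt B) z \<longrightarrow> yields P (Nt s) (u @ z @ v))"
        using rhs \<open>1 \<le> r\<close> \<open>r \<le> M\<close> by (intro yields_midsize) auto
      then obtain B u w v where
        "B \<in> fst ` P" "zip x (h N) = u @ w @ v" "yields P (Nt B) w" "length w \<le> M"
        "M < r * length w" "\<forall>z. yields P (Nt B) z \<longrightarrow> yields P (Nt s) (u @ z @ v)"
        by blast
      then have "Q x B (length u) (length w)" unfolding Q_def SP gen_lang_eq_yields by blast
      then show ?thesis by (intro exI[of _ "(B, length u, length w)"]) simp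
    qed
    then obtain t where t: "\<And>x. x \<in> U \<Longrightarrow> Q x (fst (t x)) (fst (snd (t x))) (snd (snd (t x)))"
      by metis
    have bound: "i + j \<le> N" if "Q x B i j" "x \<in> U" for x B i j
    proof -
      obtain u w v where "zip x (h N) = u @ w @ v" "length u = i" "length w = j"
        using \<open>Q x B i j\<close> unfolding Q_def by blast
      moreover have "length (zip x (h N)) = N" using h len \<open>x \<in> U\<close> by simp
      ultimately show ?thesis by simp
    qed
    have "t ` U \<subseteq> fst ` P \<times> {..N} \<times> {..N}"
    proof
      fix a assume "a \<in> t ` U"
      then obtain x where x: "x \<in> U" "a = t x" by blast
      then show "a \<in> fst ` P \<times> {..N} \<times> {..N}"
        using t[OF x(1)] bound[OF t[OF x(1)] x(1)] by (cases "t x") (auto simp: Q_def)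
    qed
    then have "card (t ` U) \<le> card (fst ` P \<times> {..N} \<times> {..N})"
      by (intro card_mono) (simp_all add: fin)
    also have "\<dots> = m * (N + 1)^2" by (simp add: m_def card_cartesian_product power2_eq_square)
    \<comment> \<open>There are more words than types, so two distinct words share one.\<close>
    finally have "\<not> inj_on t U" using card pigeonhole[of t U] by simp
    then obtain x y where xy: "x \<in> U" "y \<in> U" "x \<noteq> y" "t x = t y" by (auto simp: inj_on_def)
    obtain B i j where Qx: "Q x B i j" and Qy: "Q y B i j"
      using t[OF xy(1)] t[OF xy(2)] xy(4) by metis
    obtain u w v where 1: "zip x (h N) = u @ w @ v" "length u = i" "length w = j"
        "\<And>z. yields P (Nt B) z \<Longrightarrow> u @ z @ v \<in> S"
      using Qx unfolding Q_def by blast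
    obtain u' w' v' where 2: "zip y (h N) = u' @ w' @ v'" "length u' = i" "length w' = j"
        "yields P (Nt B) w'"
      using Qy unfolding Q_def by blast
    define g where "g = take i x @ take j (drop i y) @ drop (i + j) x"
    note ij = bound[OF Qx xy(1)]
    have "u = zip (take i x) (take i (h N))"
      using 1 by (metis append_eq_conv_conj take_zip)
    moreover have "w' = zip (take j (drop i y)) (take j (drop i (h N)))"
      using 2 by (metis append_eq_conv_conj take_zip drop_zip)
    moreover have "v = zip (drop (i + j) x) (drop (i + j) (h N))"
      using 1 by (metis append_eq_conv_conj drop_zip drop_drop add.commute)
    \<comment> \<open>Both factors occupy the same positions, so the pieces of advice fit together
      to \<open>h N\<close> again.\<close>
    ultimately have "u @ w' @ v = zip g (take i (h N) @ take j (drop i (h N)) @ drop (i + j) (h N))"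
      unfolding g_def using ij h[of N] len[OF xy(1)] len[OF xy(2)] by (simp add: zip_append)
    also have "take i (h N) @ take j (drop i (h N)) @ drop (i + j) (h N) = h N"
      by (metis append_take_drop_id drop_drop add.commute)
    finally have "zip g (h N) \<in> S" using 1(4)[OF 2(4)] by simp
    moreover have "length g = N" unfolding g_def using ij len[OF xy(1)] len[OF xy(2)] by simp
    moreover have "set g \<subseteq> \<Sigma>"
      unfolding g_def using xy(1,2) UL L
      by (auto dest!: in_set_takeD in_set_dropD)
    ultimately have "g \<in> L" using LS[of g] by auto
    moreover have "j \<le> M" "M < r * j" using Qx unfolding Q_def by blast+
    ultimately show "\<exists>x \<in> U. \<exists>y \<in> U. \<exists>i j. x \<noteq> y \<and> i + j \<le> N \<and> j \<le> M \<and> M < r * j \<and>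
        take i x @ take j (drop i y) @ drop (i + j) x \<in> L"
      using xy(1-3) ij unfolding g_def by blast
  qed
qed

section \<open>The witness language on words of four blocks\<close>

definition track :: "bool \<Rightarrow> nat set" where
  "track k = (if k then {0, 1} else {2, 3})"

definition two_palindromes :: "nat list set" where
  "two_palindromes = {w \<in> lists {..<4}.
     \<forall>k. rev (filter (\<lambda>a. a \<in> track k) w) = filter (\<lambda>a. a \<in> track k) w}"

lemma lessThan_4: "{..<4} = track k \<union> track (\<not> k)"
  unfolding track_def by auto

text \<open>Blocks 0 and 2 lie in one track, blocks 1 and 3 in the other, so the two subwords are
  \<open>B 0 @ B 2\<close> and \<open>B 1 @ B 3\<close>. As the blocks have equal length, each is a
  palindrome iff one block is the reverse of the other.\<close>

lemma two_palindromes_blocks: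
  assumes f: "\<And>p. p < 4 * n \<Longrightarrow> f p \<in> track (even (p div n))"
  shows "map f [0..<4*n] \<in> two_palindromes \<longleftrightarrow>
    (\<forall>p<n. f p = f (3*n - 1 - p) \<and> f (n + p) = f (4*n - 1 - p))"
proof -
  define B where "B c = map (\<lambda>p. f (c * n + p)) [0..<n]" for c
  have "[0..<4*n] = [0..<n] @ [n..<2*n] @ [2*n..<3*n] @ [3*n..<4*n]"
    using upt_add_eq_append[of 0 n "3*n"] upt_add_eq_append[of n "2*n" "2*n"]
      upt_add_eq_append[of "2*n" "3*n" n] by simp
  moreover have "map f [c*n..<(Suc c)*n] = B c" for c
    unfolding B_def by (intro nth_equalityI) auto
  from this[of 0] this[of 1] this[of 2] this[of 3]
  have "map f [0..<n] = B 0" "map f [n..<2*n] = B 1" "map f [2*n..<3*n] = B 2" "map f [3*n..<4*n] = B 3"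
    by (simp_all add: numeral_eq_Suc)
  ultimately have w: "map f [0..<4*n] = B 0 @ B 1 @ B 2 @ B 3" by simp
  have B: "set (B c) \<subseteq> track (even c)" if "c < 4" for c
  proof
    fix a assume "a \<in> set (B c)"
    then obtain p where p: "p < n" "a = f (c * n + p)" unfolding B_def by auto
    have "c * n + p < (c + 1) * n" using p by simp
    also have "\<dots> \<le> 4 * n" using that by (intro mult_le_mono1) simp
    finally show "a \<in> track (even c)" using f[of "c * n + p"] p by simp
  qed
  have "filter (\<lambda>a. a \<in> track k) (B c) = (if k = even c then B c else [])" if "c < 4" for c k
  proof -
    have "track k \<inter> track k' = {}" if "k \<noteq> k'" for k k'
      using that by (auto simp: track_def)
    then show ?thesis
      using B[OF that] by (cases "k = even c") (auto simp: filter_empty_conv subset_iff intro!: filter_True)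
  qed
  then have "filter (\<lambda>a. a \<in> track True) (map f [0..<4*n]) = B 0 @ B 2"
    "filter (\<lambda>a. a \<in> track False) (map f [0..<4*n]) = B 1 @ B 3"
    unfolding w by simp_all
  moreover have "map f [0..<4*n] \<in> lists {..<4}"
    using f lessThan_4 by fastforce
  ultimately have "map f [0..<4*n] \<in> two_palindromes \<longleftrightarrow> B 0 = rev (B 2) \<and> B 1 = rev (B 3)"
    unfolding two_palindromes_def by (auto simp: all_bool_eq B_def)
  also have "\<dots> \<longleftrightarrow> (\<forall>p<n. f p = f (3*n - 1 - p) \<and> f (n + p) = f (4*n - 1 - p))"
  proof -
    have "2*n + (n - Suc p) = 3*n - 1 - p" "3*n + (n - Suc p) = 4*n - 1 - p" if "p < n" for p
      using that by auto
    then show ?thesis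
      by (auto simp: list_eq_iff_nth_eq B_def rev_nth)
  qed
  finally show ?thesis .
qed

text \<open>Serves to choose \<open>l\<close>: the left side will bound the number of types for
  words of length \<open>8 * r * l\<close>, the right side counts the binary words of length
  \<open>l\<close>.\<close>

lemma exp_beats_quadratic:
  fixes m r :: nat
  assumes "1 \<le> r"
  shows "\<exists>l\<ge>1. m * (8 * r * l + 1)^2 < 2 ^ l"
proof -
  \<comment> \<open>\<open>t\<close> absorbs the constants, where 625 is the square of 25. The left
    side is then at most \<open>t^3\<close>, and \<open>t < 2^t\<close> settles
    \<open>l = 3 * t\<close>.\<close>
  define t where "t = 1 + m * 625 * r^2"
  have t: "1 \<le> t" "m * 625 * r^2 \<le> t" by (simp_all add: t_def)
  have "8 * r * (3 * t) + 1 \<le> 25 * (r * t)" using assms t by (simp add: Suc_le_eq)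
  then have "m * (8 * r * (3 * t) + 1)^2 \<le> m * (25 * (r * t))^2"
    by (intro mult_le_mono2 power_mono) auto
  also have "\<dots> = (m * 625 * r^2) * t^2" by (simp add: power_mult_distrib)
  also have "\<dots> \<le> t * t^2" using t by (intro mult_le_mono1)
  also have "\<dots> = t^3" by (simp add: power2_eq_square power3_eq_cube)
  also have "\<dots> < (2 ^ t)^3" by (intro power_strict_mono) (simp_all add: less_exp)
  also have "(2 ^ t)^3 = (2::nat) ^ (3 * t)" by (simp add: power_mult[symmetric] mult.commute)
  finally show ?thesis using t by (intro exI[of _ "3 * t"]) simp
qed

text \<open>Mirroring a range of complete periods mirrors the residues: if
  \<open>p = l * a + b\<close>, the image is a multiple of \<open>l\<close> plus
  \<open>l - 1 - b\<close>.\<close>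

lemma mod_mirror:
  fixes l p k :: nat
  assumes "p < l * k"
  shows "(l * k - 1 - p) mod l = l - 1 - p mod l"
proof -
  define a b where "a = p div l" and "b = p mod l"
  have l: "0 < l" using assms by (cases l) auto
  have p: "p = l * a + b" and b: "b < l" using l by (simp_all add: a_def b_def)
  have "a < k" using assms unfolding a_def by (simp add: less_mult_imp_div_less mult.commute)
  then obtain d where "k = a + 1 + d" by (metis add.commute less_iff_Suc_add Suc_eq_plus1 add.assoc)
  then have "l * k - 1 - p = l * d + (l - 1 - b)" using b by (simp add: p algebra_simps)
  then have "(l * k - 1 - p) mod l = l - 1 - b" using l by simp
  then show ?thesis by (simp add: b_def)
qed

lemma residue_in_interval:
  fixes i l q :: nat
  assumes "q < l"
  shows "\<exists>p. i \<le> p \<and> p < i + l \<and> p mod l = q"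
proof -
  define p where "p = i + (q + (l - i mod l)) mod l"
  have "p mod l = (i mod l + (q + (l - i mod l))) mod l"
    unfolding p_def by (metis mod_add_left_eq mod_add_right_eq)
  also have "i mod l + (q + (l - i mod l)) = q + l"
    using assms mod_less_divisor[of l i] by linarith
  finally have "p mod l = q" using assms by simp
  moreover have "p < i + l" unfolding p_def using assms by simp
  ultimately show ?thesis unfolding p_def by (metis le_add1)
qed

theorem two_palindromes_not_advised_CFL: "two_palindromes \<notin> with_advice CFL"
proof
  assume "two_palindromes \<in> with_advice CFL"
  then show False
  proof (rule advised_CFL_swap)
    fix m r
    assume r: "1 \<le> r" and swap:
      "\<And>N M U. \<lbrakk>U \<subseteq> two_palindromes; \<And>x. x \<in> U \<Longrightarrow> length x = N; r \<le> M; M < N; m * (N + 1)^2 < card U\<rbrakk> \<Longrightarrow>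
        \<exists>x \<in> U. \<exists>y \<in> U. \<exists>i j. x \<noteq> y \<and> i + j \<le> N \<and> j \<le> M \<and> M < r * j \<and>
          take i x @ take j (drop i y) @ drop (i + j) x \<in> two_palindromes"
    obtain l where l: "l \<ge> 1" "m * (8 * r * l + 1)^2 < 2 ^ l" using exp_beats_quadratic[OF r] by blast
    \<comment> \<open>With this \<open>n\<close>, an exchanged factor with \<open>n < r * j\<close>
      is longer than \<open>2 * l\<close>, and \<open>4 * n + 1\<close> is the base squared in the
      choice of \<open>l\<close>.\<close>
    define n where "n = 2 * r * l"
    have n: "n \<ge> 1" "r \<le> n" "n < 4 * n" using l r by (auto simp: n_def)
    have dvd: "l dvd n" by (simp add: n_def)
    \<comment> \<open>The first half repeats \<open>u\<close> and the second half repeats its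
      reverse, so matched positions read the same letter of \<open>u\<close>.\<close>
    define ix where "ix p = (if p < 2 * n then p mod l else l - 1 - p mod l)" for p
    have ix: "ix p < l" for p
    proof -
      have "0 < l" using l(1) by simp
      then show ?thesis unfolding ix_def by (simp add: less_imp_diff_less)
    qed
    define F where "F u p = (if even (p div n) then 0 else 2) + u ! ix p" for u :: "nat list" and p
    define W where "W u = map (F u) [0..<4*n]" for u
    define V where "V = {u. set u \<subseteq> {0, 1::nat} \<and> length u = l}"
    have F_track: "F u p \<in> track (even (p div n))" if "u \<in> V" for u p
    proof -
      have "u ! ix p \<in> {0, 1}" using that nth_mem[of "ix p" u] ix[of p] unfolding V_def by blast
      then show ?thesis by (auto simp: F_def track_def)
    qed
    have mirror: "l - 1 - (c * n - 1 - p) mod l = p mod l" if "p < c * n" for c p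
    proof -
      obtain k where "c * n = l * k" using dvd by (metis dvd_def dvd_mult)
      then have "(c * n - 1 - p) mod l = l - 1 - p mod l"
        using mod_mirror[of p l k] that by simp
      moreover have "p mod l < l" using l(1) by simp
      ultimately show ?thesis by linarith
    qed
    have W_pal: "W u \<in> two_palindromes" if "u \<in> V" for u
      unfolding W_def
    proof (subst two_palindromes_blocks, goal_cases)
      case (1 p)
      show ?case using F_track[OF that] .
    next
      case 2
      show ?case
      proof (intro allI impI conjI)
        fix p assume p: "p < n"
        have "(3*n - 1 - p) div n = 2" "(4*n - 1 - p) div n = 3"
          using p by (intro div_nat_eqI; simp)+
        moreover have "p div n = 0" "(n + p) div n = 1" using p by simp_all
        moreover have "ix (3*n - 1 - p) = p mod l"
          using mirror[of p 3] p by (simp add: ix_def)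
        \<comment> \<open>The factor 5 arises because \<open>5 * n - 1 - (n + p)\<close> is
          \<open>4 * n - 1 - p\<close>.\<close>
        moreover have "ix (4*n - 1 - p) = (n + p) mod l"
          using mirror[of "n + p" 5] p by (simp add: ix_def)
        moreover have "ix p = p mod l" "ix (n + p) = (n + p) mod l" using p by (simp_all add: ix_def)
        ultimately show "F u p = F u (3*n - 1 - p)" "F u (n + p) = F u (4*n - 1 - p)"
          by (simp_all only: F_def) simp_all
      qed
    qed
    have recover: "u = u'" if "u \<in> V" "u' \<in> V" "n < r * j" "i + j \<le> 4 * n"
      and eq: "\<And>p. i \<le> p \<Longrightarrow> p < i + j \<Longrightarrow> F u p = F u' p" for u u' i j
    proof (rule nth_equalityI)
      show "length u = length u'" using that by (simp add: V_def)
      fix q assume "q < length u"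
      then have q: "q < l" using that by (simp add: V_def)
      have "r * (2 * l) < r * j" using that(3) by (simp add: n_def mult.assoc mult.left_commute)
      then have j: "2 * l < j" by simp
      \<comment> \<open>The window is longer than \<open>2 * l\<close>. Either its first
        \<open>l\<close> positions lie in the first half, or the next \<open>l\<close> lie in the
        second half, where the residue to look for is \<open>l - 1 - q\<close>.\<close>
      have "\<exists>p. i \<le> p \<and> p < i + j \<and> ix p = q"
      proof (cases "i + l \<le> 2 * n")
        case True
        obtain p where "i \<le> p" "p < i + l" "p mod l = q" using residue_in_interval[OF q] by blast
        then show ?thesis using True j by (intro exI[of _ p]) (simp add: ix_def)
      next
        case False
        obtain p where "i + l \<le> p" "p < i + l + l" "p mod l = l - 1 - q"
          using residue_in_interval[of "l - 1 - q" l "i + l"] q by auto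
        then show ?thesis using False j q by (intro exI[of _ p]) (simp add: ix_def)
      qed
      then show "u ! q = u' ! q" using eq unfolding F_def by auto
    qed
    have "inj_on W V"
    proof (rule inj_onI)
      fix u u' assume "u \<in> V" "u' \<in> V" "W u = W u'"
      moreover have "n < r * (4 * n)" using n r by (metis less_le_trans mult_le_mono1 nat_mult_1)
      ultimately show "u = u'"
        using recover[of u u' "4 * n" 0] by (auto simp: W_def)
    qed
    then have "card (W ` V) = 2 ^ l"
      using card_lists_length_eq[of "{0, 1::nat}" l] by (simp add: card_image V_def numeral_2_eq_2)
    then have "m * (4 * n + 1)^2 < card (W ` V)" using l(2) by (simp add: n_def mult.assoc)
    then have "\<exists>x \<in> W ` V. \<exists>y \<in> W ` V. \<exists>i j. x \<noteq> y \<and> i + j \<le> 4 * n \<and> j \<le> n \<and> n < r * j \<and>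
        take i x @ take j (drop i y) @ drop (i + j) x \<in> two_palindromes"
      using n W_pal by (intro swap) (auto simp: W_def)
    then obtain u u' i j where
      u: "u \<in> V" "u' \<in> V" "W u \<noteq> W u'" "i + j \<le> 4 * n" "j \<le> n" "n < r * j"
      and sw: "take i (W u) @ take j (drop i (W u')) @ drop (i + j) (W u) \<in> two_palindromes"
      by blast
    define G where "G p = (if i \<le> p \<and> p < i + j then F u' p else F u p)" for p
    have "take i (W u) @ take j (drop i (W u')) @ drop (i + j) (W u) = map G [0..<4*n]"
      using u(4) by (intro nth_equalityI) (auto simp: W_def G_def nth_append)
    with sw have "map G [0..<4*n] \<in> two_palindromes" by simp
    then have G: "\<And>p. p < n \<Longrightarrow> G p = G (3*n - 1 - p) \<and> G (n + p) = G (4*n - 1 - p)"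
      by (subst (asm) two_palindromes_blocks) (auto simp: G_def F_track u)
    have Fu: "F u p = F u (3*n - 1 - p) \<and> F u (n + p) = F u (4*n - 1 - p)" if "p < n" for p
      using W_pal[OF u(1)] that unfolding W_def
      by (subst (asm) two_palindromes_blocks) (auto simp: F_track u)
    have Fu': "F u' p = F u' (3*n - 1 - p) \<and> F u' (n + p) = F u' (4*n - 1 - p)" if "p < n" for p
      using W_pal[OF u(2)] that unfolding W_def
      by (subst (asm) two_palindromes_blocks) (auto simp: F_track u)
    \<comment> \<open>Matched positions are more than \<open>n\<close> apart, so the partner of
      \<open>p\<close> lies outside the exchanged factor and still carries its letter from
      \<open>W u\<close>. Membership of the spliced word and of \<open>W u\<close> then equates both
      \<open>F u' p\<close> and \<open>F u p\<close> with that letter.\<close>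
    have "F u p = F u' p" if p: "i \<le> p" "p < i + j" for p
    proof -
      consider a where "a < n" "p = a \<or> p = 3*n - 1 - a" | a where "a < n" "p = n + a \<or> p = 4*n - 1 - a"
      proof -
        consider "p < n" | "n \<le> p" "p < 2*n" | "2*n \<le> p" "p < 3*n" | "3*n \<le> p" "p < 4*n"
          using p u(4) by linarith
        then show thesis
        proof cases
          case 1 then show thesis using that(1)[of p] by simp
        next
          case 2 then show thesis using that(2)[of "p - n"] by simp
        next
          case 3 then show thesis using that(1)[of "3*n - 1 - p"] by simp
        next
          case 4 then show thesis using that(2)[of "4*n - 1 - p"] by simp
        qed
      qed
      then show ?thesis
      proof cases
        case 1
        then show ?thesis using p u(5) G[of a] Fu[of a] Fu'[of a] by (auto simp: G_def split: if_splits)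
      next
        case 2
        then show ?thesis using p u(5) G[of a] Fu[of a] Fu'[of a] by (auto simp: G_def split: if_splits)
      qed
    qed
    then have "u = u'" using recover[OF u(1,2,6,4)] by blast
    then show False using u(3) by simp
  qed
qed

section \<open>Simulating a two-way counter machine in logarithmic space\<close>

datatype counter_op = Keep | Inc | Dec

datatype 'q action = Halt bool | Go 'q dir counter_op

fun count :: "counter_op \<Rightarrow> nat \<Rightarrow> nat" where
  "count Keep c = c"
| "count Inc c = c + 1"
| "count Dec c = c - 1"

text \<open>The control sees of the counter only whether it is 0. The bound on the new value is part
  of the step, so a run from counter 0 keeps the binary counter short. A \<open>Halt\<close> action
  has no successor.\<close>

inductive counter_step :: "('q \<Rightarrow> 'a insym \<Rightarrow> bool \<Rightarrow> 'q action) \<Rightarrow> 'a list \<Rightarrow>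
    'q \<times> nat \<times> nat \<Rightarrow> 'q \<times> nat \<times> nat \<Rightarrow> bool" for \<delta> x where
  "\<delta> q (input_at x p) (c = 0) = Go q' d a \<Longrightarrow> count a c \<le> length x \<Longrightarrow>
    counter_step \<delta> x (q, p, c) (q', move d p, count a c)"

section \<open>Binary counters\<close>

text \<open>Bits are listed least significant first. \<open>Dec\<close> keeps the length and so may
  leave high zeros; on a nonempty list of value 0 it would borrow past the top, a case that
  \<open>bits_val_count\<close> excludes.\<close>

fun bits_count :: "counter_op \<Rightarrow> bool list \<Rightarrow> bool list" where
  "bits_count Keep bs = bs"
| "bits_count Inc [] = [True]"
| "bits_count Inc (b # bs) = (if b then False # bits_count Inc bs else True # bs)"
| "bits_count Dec [] = []"
| "bits_count Dec (b # bs) = (if b then False # bs else True # bits_count Dec bs)"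

fun bits_val :: "bool list \<Rightarrow> nat" where
  "bits_val [] = 0"
| "bits_val (b # bs) = of_bool b + 2 * bits_val bs"

lemma bits_val_count:
  "a = Dec \<longrightarrow> bits_val bs > 0 \<Longrightarrow> bits_val (bits_count a bs) = count a (bits_val bs)"
proof (induction a bs rule: bits_count.induct)
  case (5 b bs)
  then show ?case by (cases "bits_val bs") auto
qed auto

text \<open>The list grows only when a carry leaves the top, and the value is then exactly a power
  of two. A bound on the counter values thus bounds the length, although high zeros are never
  removed.\<close>

lemma length_bits_count:
  "length (bits_count a bs) = length bs \<or>
   a = Inc \<and> length (bits_count a bs) = Suc (length bs) \<and> bits_val (bits_count a bs) = 2 ^ length bs"
  by (induction a bs rule: bits_count.induct) auto

text \<open>\<open>Scan q a z\<close> holds the next control state, the operation pending on the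
  remaining bits, and whether all bits written in this sweep are 0. \<open>Return q z\<close> holds
  the zero test of the result.\<close>

datatype 'q tm_state = Boot | Done bool | Scan 'q counter_op bool | Return 'q bool

instance counter_op :: finite
proof
  have "a \<in> {Keep, Inc, Dec}" for a :: counter_op by (cases a) simp_all
  then show "finite (UNIV :: counter_op set)"
    by (intro finite_subset[of UNIV "{Keep, Inc, Dec}"] subsetI) simp_all
qed

instance tm_state :: (finite) finite
proof
  let ?R = "{Boot} \<union> range Done \<union> range (\<lambda>(q :: 'a, a, z). Scan q a z) \<union>
      range (\<lambda>(q :: 'a, z). Return q z)"
  have "s \<in> ?R" for s :: "'a tm_state"
  proof (cases s)
    case (Scan q a z)
    then show ?thesis using rangeI[of "\<lambda>(q :: 'a, a, z). Scan q a z" "(q, a, z)"] by simp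
  next
    case (Return q z)
    then show ?thesis using rangeI[of "\<lambda>(q :: 'a, z). Return q z" "(q, z)"] by simp
  qed simp_all
  then show "finite (UNIV :: 'a tm_state set)"
    by (intro finite_subset[of UNIV ?R] subsetI) simp_all
qed

text \<open>
  Work cell 0 holds the marker 2 and the bits of the counter follow, least significant first. One
  step of the counter machine is a sweep to the first blank, which applies the operation and finds
  out whether the result is 0, and a sweep back to the marker.
\<close>

fun tm_trans :: "('q \<Rightarrow> 'a insym \<Rightarrow> bool \<Rightarrow> 'q action) \<Rightarrow> 'q \<Rightarrow> 'q tm_state \<Rightarrow> 'a insym \<Rightarrow> nat \<Rightarrow>
    'q tm_state \<times> dir \<times> nat \<times> dir" where
  "tm_trans \<delta> q0 Boot a b = (Return q0 True, Stay, 2, Stay)"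
| "tm_trans \<delta> q0 (Done r) a b = (Done r, Stay, b, Stay)"
| "tm_trans \<delta> q0 (Scan q Keep z) a b =
    (if b < 2 then (Scan q Keep (z \<and> b = 0), Stay, b, GoRight) else (Return q z, Stay, b, GoLeft))"
| "tm_trans \<delta> q0 (Scan q Inc z) a b =
    (if b = 0 then (Scan q Keep False, Stay, 1, GoRight)
     else if b = 1 then (Scan q Inc z, Stay, 0, GoRight)
     else (Return q False, Stay, 1, GoLeft))"
| "tm_trans \<delta> q0 (Scan q Dec z) a b =
    (if b = 0 then (Scan q Dec False, Stay, 1, GoRight)
     else if b = 1 then (Scan q Keep z, Stay, 0, GoRight)
     else (Return q z, Stay, b, GoLeft))"
| "tm_trans \<delta> q0 (Return q z) a b =
    (if b \<noteq> 2 then (Return q z, Stay, b, GoLeft)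
     else case \<delta> q a z of
       Halt r \<Rightarrow> (Done r, Stay, b, Stay)
     | Go q' d e \<Rightarrow> (Scan q' (if z \<and> e = Dec then Keep else e) True, d, b, GoRight))"

text \<open>Steps are deterministic, so a finite run into a fixed point passes through every
  configuration ever reached. A bound along the run becomes a bound at all times.\<close>

lemma rtranclp_funpow_invariant:
  assumes "(\<lambda>c c'. c' = f c \<and> P c)\<^sup>*\<^sup>* c0 c1" "f c1 = c1" "P c1"
  shows "P ((f ^^ t) c0)" "\<exists>t. (f ^^ t) c0 = c1"
proof -
  have fix1: "(f ^^ t) c1 = c1" for t using assms(2) by (induction t) auto
  have "(\<forall>t. P ((f ^^ t) c0)) \<and> (\<exists>t. (f ^^ t) c0 = c1)"
    using assms(1)
  proof (induction rule: converse_rtranclp_induct)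
    case base
    show ?case using fix1 assms(3) by simp
  next
    case (step c c')
    have "P ((f ^^ t) c)" for t
      using step by (cases t) (auto simp: funpow_Suc_right simp del: funpow.simps)
    moreover obtain t where "(f ^^ t) c' = c1" using step.IH by blast
    then have "(f ^^ Suc t) c = c1" using step.hyps(1) by (simp add: funpow_Suc_right del: funpow.simps)
    ultimately show ?case by blast
  qed
  then show "P ((f ^^ t) c0)" "\<exists>t. (f ^^ t) c0 = c1" by blast+
qed

section \<open>The Turing machine and its runs\<close>

locale counter_machine =
  fixes \<delta> :: "'q::finite \<Rightarrow> 'a insym \<Rightarrow> bool \<Rightarrow> 'q action" and q0 :: 'q and \<Sigma> :: "'a set"
  assumes finite_alphabet: "finite \<Sigma>"
    and no_left: "\<delta> q LeftEnd z \<noteq> Go q' GoLeft e"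
    and no_right: "\<delta> q RightEnd z \<noteq> Go q' GoRight e"
begin

text \<open>Finite state types are countable, so \<open>to_nat\<close> codes the states. The work
  symbols are the bits 0 and 1, the marker 2 and the blank 3.\<close>

definition tm :: "'a otm" where
  "tm = \<lparr>in_alph = \<Sigma>, states = range (to_nat :: 'q tm_state \<Rightarrow> nat), work_alph = {..<4}, blank = 3,
    start = to_nat (Boot :: 'q tm_state), accept = to_nat (Done True :: 'q tm_state),
    reject = to_nat (Done False :: 'q tm_state),
    delta = (\<lambda>n a b. case tm_trans \<delta> q0 (from_nat n) a b of (s, d, b', e) \<Rightarrow> (to_nat s, d, b', e))\<rparr>"

lemma tm_trans_bounds:
  assumes "b < 4" "tm_trans \<delta> q0 s a b = (s', d, b', e)"
  shows "b' < 4" "a = LeftEnd \<longrightarrow> d \<noteq> GoLeft" "a = RightEnd \<longrightarrow> d \<noteq> GoRight"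
proof -
  have "b' < 4 \<and> (a = LeftEnd \<longrightarrow> d \<noteq> GoLeft) \<and> (a = RightEnd \<longrightarrow> d \<noteq> GoRight)"
  proof (cases s)
    case (Scan q c z)
    then show ?thesis using assms by (cases c) (auto split: if_splits)
  next
    case (Return q z)
    show ?thesis
    proof (cases "\<delta> q a z")
      case (Halt r)
      then show ?thesis using assms Return by (simp split: if_splits; force)
    next
      case (Go q' d' c)
      have "\<not> (a = LeftEnd \<and> d' = GoLeft)" "\<not> (a = RightEnd \<and> d' = GoRight)"
        using no_left[of q z q' c] no_right[of q z q' c] Go by metis+
      then show ?thesis using assms Return Go by (simp split: if_split_asm; metis dir.distinct)
    qed
  qed (use assms in auto)
  then show "b' < 4" "a = LeftEnd \<longrightarrow> d \<noteq> GoLeft" "a = RightEnd \<longrightarrow> d \<noteq> GoRight" by blast+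
qed

lemma wf_tm: "wf_otm tm"
proof -
  have trans: "case delta tm q a b of (q', d, b', e) \<Rightarrow>
      q' \<in> states tm \<and> b' \<in> work_alph tm \<and>
      (a = LeftEnd \<longrightarrow> d \<noteq> GoLeft) \<and> (a = RightEnd \<longrightarrow> d \<noteq> GoRight)"
    if q_st: "q \<in> states tm" and b_alph: "b \<in> work_alph tm" for q a b
  proof -
    obtain s :: "'q tm_state" where q: "q = to_nat s" using q_st by (auto simp: tm_def)
    obtain s' d b' e where t: "tm_trans \<delta> q0 s a b = (s', d, b', e)" by (metis prod_cases4)
    show ?thesis
      using tm_trans_bounds[OF _ t] b_alph by (simp add: tm_def q t)
  qed
  have wf: "finite (in_alph tm)" "finite (states tm)" "finite (work_alph tm)"
    "blank tm \<in> work_alph tm" "start tm \<in> states tm" "accept tm \<in> states tm"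
    "reject tm \<in> states tm" "accept tm \<noteq> reject tm"
    by (simp_all add: tm_def finite_alphabet)
  show ?thesis
    unfolding wf_otm_def by (intro conjI ballI) (rule trans wf | assumption)+
qed

definition cfg :: "'q tm_state \<Rightarrow> nat \<Rightarrow> (nat \<Rightarrow> nat) \<Rightarrow> nat \<Rightarrow> config" where
  "cfg s p t w = \<lparr>cstate = to_nat s, in_pos = p, work_tape = t, work_pos = w\<rparr>"

lemma step_cfg:
  "step tm x (cfg s p t w) = (if s \<in> range Done then cfg s p t w else
    case tm_trans \<delta> q0 s (input_at x p) (t w) of (s', d, b, e) \<Rightarrow>
      cfg s' (move d p) (t(w := b)) (move e w))"
proof -
  have "to_nat s \<in> {to_nat (Done True :: 'q tm_state), to_nat (Done False :: 'q tm_state)} \<longleftrightarrow> s \<in> range Done"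
    by (auto simp: UNIV_bool)
  then show ?thesis
    unfolding step_def cfg_def tm_def by (simp split: prod.split)
qed

definition tape :: "bool list \<Rightarrow> nat \<Rightarrow> nat" where
  "tape bs i = (if i = 0 then 2 else if i \<le> length bs then of_bool (bs ! (i - 1)) else 3)"

lemma tape_0 [simp]: "tape bs 0 = 2"
  by (simp add: tape_def)

lemma tape_bit [simp]: "tape (us @ b # vs) (Suc (length us)) = of_bool b"
  by (simp add: tape_def)

lemma tape_blank [simp]: "tape us (Suc (length us)) = 3"
  by (simp add: tape_def)

lemma tape_update: "(tape (us @ b # vs))(Suc (length us) := of_bool b') = tape (us @ b' # vs)"
proof
  fix i
  consider "i = 0" | "i = Suc (length us)" | k where "i = Suc k" "k \<noteq> length us"
    by (cases i) auto
  then show "((tape (us @ b # vs))(Suc (length us) := of_bool b')) i = tape (us @ b' # vs) i"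
  proof cases
    case 3
    then show ?thesis by (cases "k < length us") (simp_all add: tape_def nth_append nth_Cons')
  qed simp_all
qed

lemma tape_extend: "(tape us)(Suc (length us) := of_bool b) = tape (us @ [b])"
proof
  fix i
  consider "i = 0" | "i = Suc (length us)" | k where "i = Suc k" "k \<noteq> length us"
    by (cases i) auto
  then show "((tape us)(Suc (length us) := of_bool b)) i = tape (us @ [b]) i"
  proof cases
    case 3
    then show ?thesis by (cases "k < length us") (simp_all add: tape_def nth_append)
  qed simp_all
qed

text \<open>The bound concerns only the configurations from which a step is taken; the last one is
  bounded separately.\<close>

definition run :: "'a list \<Rightarrow> nat \<Rightarrow> config \<Rightarrow> config \<Rightarrow> bool" where
  "run x s = (\<lambda>c c'. c' = step tm x c \<and> work_pos c < s)\<^sup>*\<^sup>*"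

lemma run_trans: "run x s a b \<Longrightarrow> run x s b c \<Longrightarrow> run x s a c"
  unfolding run_def by (rule rtranclp_trans)

lemma run_step: "step tm x a = b \<Longrightarrow> work_pos a < s \<Longrightarrow> run x s b c \<Longrightarrow> run x s a c"
  unfolding run_def by (rule converse_rtranclp_into_rtranclp) auto

lemma run_refl: "run x s a a"
  unfolding run_def by simp

lemma run_step1: "step tm x a = b \<Longrightarrow> work_pos a < s \<Longrightarrow> run x s a b"
  using run_step run_refl by blast

lemma work_pos_cfg [simp]: "work_pos (cfg s p t w) = w"
  by (simp add: cfg_def)

text \<open>Induction on the bits \<open>vs\<close> still ahead, with the finished bits in
  \<open>us\<close>. The head turns at the first blank and ends on cell
  \<open>length us + length vs\<close>, also when \<open>Inc\<close> has appended a bit in the blank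
  cell.\<close>

lemma run_scan:
  assumes "length us + length vs + 1 < s"
  shows "run x s (cfg (Scan q a z) p (tape (us @ vs)) (Suc (length us)))
    (cfg (Return q (z \<and> bits_val (bits_count a vs) = 0)) p (tape (us @ bits_count a vs)) (length us + length vs))"
  using assms
proof (induction vs arbitrary: us a z)
  case Nil
  let ?w = "Suc (length us)"
  have "step tm x (cfg (Scan q a z) p (tape us) ?w) =
      cfg (Return q (z \<and> bits_val (bits_count a []) = 0)) p (tape (us @ bits_count a [])) (length us)"
    using tape_extend[of us True] by (cases a) (auto simp: step_cfg fun_upd_idem)
  from run_step1[OF this, of s] show ?case using Nil by simp
next
  case (Cons b vs)
  let ?w = "Suc (length us)"
  obtain a' b' z' where *: "step tm x (cfg (Scan q a z) p (tape (us @ b # vs)) ?w) =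
      cfg (Scan q a' z') p (tape (us @ b' # vs)) (Suc ?w)"
    and bits: "bits_count a (b # vs) = b' # bits_count a' vs"
    and zero: "(z' \<and> bits_val (bits_count a' vs) = 0) \<longleftrightarrow> (z \<and> bits_val (bits_count a (b # vs)) = 0)"
  proof
    \<comment> \<open>Uniform form of the transitions on a bit: every operation but
      \<open>Keep\<close> flips it, and the operation stays pending exactly while it carries or
      borrows.\<close>
    let ?b' = "if a = Keep then b else \<not> b"
    let ?a' = "if a = Inc \<and> b \<or> a = Dec \<and> \<not> b then a else Keep"
    let ?z' = "z \<and> \<not> ?b'"
    show "step tm x (cfg (Scan q a z) p (tape (us @ b # vs)) ?w) =
      cfg (Scan q ?a' ?z') p (tape (us @ ?b' # vs)) (Suc ?w)"
      using tape_update[of us b vs True] tape_update[of us b vs False]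
      by (cases a; cases b) (auto simp: step_cfg)
    show "bits_count a (b # vs) = ?b' # bits_count ?a' vs" by (cases a; cases b) auto
    show "(?z' \<and> bits_val (bits_count ?a' vs) = 0) \<longleftrightarrow> (z \<and> bits_val (bits_count a (b # vs)) = 0)"
      by (cases a; cases b) auto
  qed
  show ?case
    using run_step[OF *, of s] Cons.IH[of "us @ [b']" a' z'] Cons.prems
    unfolding bits zero by simp
qed

lemma run_return:
  assumes "i \<le> length bs" "i < s"
  shows "run x s (cfg (Return q z) p (tape bs) i) (cfg (Return q z) p (tape bs) 0)"
  using assms
proof (induction i)
  case 0
  show ?case by (rule run_refl)
next
  case (Suc i)
  have "tape bs (Suc i) \<noteq> 2" using Suc.prems by (simp add: tape_def)
  then have "step tm x (cfg (Return q z) p (tape bs) (Suc i)) = cfg (Return q z) p (tape bs) i"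
    by (auto simp: step_cfg)
  from run_step[OF this, of s] show ?case using Suc by simp
qed

text \<open>\<open>floorlog 2 n\<close> is the number of binary digits of \<open>n\<close>; two more
  cells hold the marker and the first blank.\<close>

definition space :: "nat \<Rightarrow> nat" where
  "space n = floorlog 2 n + 2"

text \<open>Bounds the number of bits rather than the value, because high zeros left by decrements
  count as cells.\<close>

definition fits :: "nat \<Rightarrow> bool list \<Rightarrow> bool" where
  "fits n bs \<longleftrightarrow> bs = [] \<or> 2 ^ (length bs - 1) \<le> n"

lemma fits_space: "fits n bs \<Longrightarrow> length bs + 1 < space n"
  using floorlog_geI[of 2 "length bs" n] unfolding fits_def space_def by auto

lemma run_counter_step:
  assumes "counter_step \<delta> x (q, p, bits_val bs) (q', p', c')" "fits (length x) bs"
  shows "\<exists>bs'. bits_val bs' = c' \<and> fits (length x) bs' \<and> run x (space (length x))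
    (cfg (Return q (bits_val bs = 0)) p (tape bs) 0) (cfg (Return q' (c' = 0)) p' (tape bs') 0)"
  using assms(1)
proof (cases rule: counter_step.cases)
  case (1 d a)
  \<comment> \<open>Truncated subtraction leaves 0 unchanged under \<open>Dec\<close>, where the
    bitwise decrement would borrow; the machine performs \<open>Keep\<close> instead.\<close>
  define e where "e = (if bits_val bs = 0 \<and> a = Dec then Keep else a)"
  define bs' where "bs' = bits_count e bs"
  have val: "bits_val bs' = c'"
    unfolding bs'_def by (subst bits_val_count) (auto simp: e_def 1)
  \<comment> \<open>Either the length is unchanged, or the new value is
    \<open>2 ^ length bs\<close>, which the counter step bounds by \<open>length x\<close>.\<close>
  have fits: "fits (length x) bs'"
    using length_bits_count[of e bs] assms(2) val 1 unfolding bs'_def[symmetric] fits_def by force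
  note sp = fits_space[OF assms(2)]
  have step: "step tm x (cfg (Return q (bits_val bs = 0)) p (tape bs) 0) = cfg (Scan q' e True) p' (tape bs) 1"
    using 1 by (simp add: step_cfg image_iff e_def fun_upd_idem)
  have scan: "run x (space (length x)) (cfg (Scan q' e True) p' (tape bs) 1)
      (cfg (Return q' (c' = 0)) p' (tape bs') (length bs))"
    using run_scan[of "[]" bs "space (length x)" x q' e True p'] sp val by (simp add: bs'_def)
  have return: "run x (space (length x)) (cfg (Return q' (c' = 0)) p' (tape bs') (length bs))
      (cfg (Return q' (c' = 0)) p' (tape bs') 0)"
    using length_bits_count[of e bs] sp by (intro run_return) (auto simp: bs'_def)
  have "run x (space (length x)) (cfg (Return q (bits_val bs = 0)) p (tape bs) 0)
      (cfg (Return q' (c' = 0)) p' (tape bs') 0)"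
    by (rule run_step[OF step _ run_trans[OF scan return]]) (use sp in simp)
  then show ?thesis using val fits by blast
qed

lemma run_counter_steps:
  assumes "(counter_step \<delta> x)\<^sup>*\<^sup>* (q0, 0, 0) (q, p, c)"
  shows "\<exists>bs. bits_val bs = c \<and> fits (length x) bs \<and>
    run x (space (length x)) (init tm) (cfg (Return q (c = 0)) p (tape bs) 0)"
  using assms
proof (induction "(q, p, c)" arbitrary: q p c rule: rtranclp_induct)
  case base
  have "init tm = cfg Boot 0 (\<lambda>_. 3) 0" by (simp add: init_def tm_def cfg_def)
  moreover have "(\<lambda>_. 3)(0 := 2) = tape []" by (auto simp: tape_def)
  ultimately have "step tm x (init tm) = cfg (Return q0 True) 0 (tape []) 0"
    by (simp add: step_cfg image_iff)
  then have "run x (space (length x)) (init tm) (cfg (Return q0 True) 0 (tape []) 0)"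
    by (rule run_step1) (simp add: init_def space_def)
  then show ?case by (intro exI[of _ "[]"]) (simp add: fits_def)
next
  case (step y)
  obtain q' p' c' where y: "y = (q', p', c')" by (cases y)
  from step.hyps(3)[OF y] obtain bs where bs: "bits_val bs = c'" "fits (length x) bs"
    "run x (space (length x)) (init tm) (cfg (Return q' (c' = 0)) p' (tape bs) 0)" by blast
  then show ?case
    using run_counter_step[of x q' p' bs q p c] step.hyps(2) run_trans unfolding y by blast
qed

lemma run_halt:
  assumes "(counter_step \<delta> x)\<^sup>*\<^sup>* (q0, 0, 0) (q, p, c)" "\<delta> q (input_at x p) (c = 0) = Halt r"
  shows "work_pos (config_at tm x t) < space (length x)"
    "\<exists>t. cstate (config_at tm x t) = to_nat (Done r :: 'q tm_state)"
proof -
  obtain bs where bs: "run x (space (length x)) (init tm) (cfg (Return q (c = 0)) p (tape bs) 0)"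
    using run_counter_steps[OF assms(1)] by blast
  have "step tm x (cfg (Return q (c = 0)) p (tape bs) 0) = cfg (Done r) p (tape bs) 0"
    using assms(2) by (simp add: step_cfg image_iff fun_upd_idem)
  then have "run x (space (length x)) (cfg (Return q (c = 0)) p (tape bs) 0) (cfg (Done r) p (tape bs) 0)"
    by (rule run_step1) (simp add: space_def)
  with bs have "run x (space (length x)) (init tm) (cfg (Done r) p (tape bs) 0)" by (rule run_trans)
  moreover have "step tm x (cfg (Done r) p (tape bs) 0) = cfg (Done r) p (tape bs) 0"
    by (simp add: step_cfg)
  moreover have "work_pos (cfg (Done r) p (tape bs) 0) < space (length x)" by (simp add: space_def)
  ultimately have *: "work_pos ((step tm x ^^ t) (init tm)) < space (length x)"
    "\<exists>t. (step tm x ^^ t) (init tm) = cfg (Done r) p (tape bs) 0" for t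
    unfolding run_def by (rule rtranclp_funpow_invariant)+
  show "work_pos (config_at tm x t) < space (length x)"
    unfolding config_at_def by (rule *)
  show "\<exists>t. cstate (config_at tm x t) = to_nat (Done r :: 'q tm_state)"
    using *(2) unfolding config_at_def by (metis cfg_def config.select_convs(1))
qed

lemma space_bigo: "(\<lambda>n. real (space n)) \<in> O(\<lambda>n. ln (real n))"
proof (rule bigoI[where c = "1 / ln 2 + 3"])
  show "\<forall>\<^sub>F n in sequentially. norm (real (space n)) \<le> (1 / ln 2 + 3) * norm (ln (real n))"
    using eventually_ge_at_top[of "3::nat"]
  proof eventually_elim
    case (elim n)
    \<comment> \<open>From 3 on the logarithm is at least 1 and absorbs the additive constant
      3.\<close>
    have "3 \<le> real n" using elim by simp
    then have "exp 1 \<le> real n" using exp_le by linarith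
    then have ln: "1 \<le> ln (real n)" using elim by (simp add: ln_ge_iff)
    have "real (space n) \<le> log 2 (real n) + 3"
      using elim by (simp add: space_def floorlog_def)
    also have "\<dots> \<le> (1 / ln 2) * ln (real n) + 3 * ln (real n)" using ln by (simp add: log_def)
    finally show ?case using ln by (simp add: distrib_right)
  qed
qed

theorem LOGSPACE_if_decides:
  assumes "L \<subseteq> lists \<Sigma>"
    and dec: "\<And>x. x \<in> lists \<Sigma> \<Longrightarrow> \<exists>q p c. (counter_step \<delta> x)\<^sup>*\<^sup>* (q0, 0, 0) (q, p, c) \<and>
      \<delta> q (input_at x p) (c = 0) = Halt (x \<in> L)"
  shows "L \<in> LOGSPACE"
proof -
  have in_alph: "in_alph tm = \<Sigma>" by (simp add: tm_def)
  have halt: "work_pos (config_at tm x t) < space (length x)"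
    "\<exists>t. cstate (config_at tm x t) = to_nat (Done (x \<in> L) :: 'q tm_state)" if x: "x \<in> lists \<Sigma>" for x t
  proof -
    obtain q p c where *: "(counter_step \<delta> x)\<^sup>*\<^sup>* (q0, 0, 0) (q, p, c)"
      "\<delta> q (input_at x p) (c = 0) = Halt (x \<in> L)" using dec[OF x] by blast
    show "work_pos (config_at tm x t) < space (length x)" by (rule run_halt(1)[OF *])
    show "\<exists>t. cstate (config_at tm x t) = to_nat (Done (x \<in> L) :: 'q tm_state)"
      by (rule run_halt(2)[OF *])
  qed
  have "runs_in_space tm space" unfolding runs_in_space_def in_alph using halt(1) by blast
  moreover have "recognizes tm L"
    unfolding recognizes_def accepts_def rejects_def in_alph
  proof (intro conjI ballI impI)
    fix x assume x: "x \<in> lists \<Sigma>"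
    show "\<exists>t. cstate (config_at tm x t) = accept tm" if "x \<in> L"
      using halt(2)[OF x] that by (simp add: tm_def)
    show "\<exists>t. cstate (config_at tm x t) = reject tm" if "x \<notin> L"
      using halt(2)[OF x] that by (simp add: tm_def)
  qed (fact assms(1))
  ultimately show ?thesis unfolding LOGSPACE_def using wf_tm space_bigo by blast
qed

end

section \<open>Recognizing the language with one counter\<close>

lemma count_pow [simp]:
  "(count Keep ^^ n) c = c" "(count Inc ^^ n) c = c + n" "(count Dec ^^ n) c = c - n"
  by (induction n) auto

lemma input_at_simps [simp]:
  "input_at x 0 = LeftEnd"
  "input_at (u @ a # v) (Suc (length u)) = Input a"
  "input_at x (Suc (length x)) = RightEnd"
  by (simp_all add: input_at_def)

lemma counter_stepI:
  assumes "\<delta> q (input_at x p) (c = 0) = Go q' d a" "count a c \<le> length x" "p' = move d p" "c' = count a c"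
  shows "counter_step \<delta> x (q, p, c) (q', p', c')"
  using counter_step.intros[of \<delta> q x p c q' d a] assms by simp

text \<open>A whole pass in one state, applying \<open>e\<close> at each letter of \<open>T\<close>.
  For \<open>Dec\<close> the rule is required only at a nonzero counter, since the machine stops
  dropping at 0; \<open>n \<le> c\<close> keeps the pass within that case.\<close>

lemma sweep_right:
  assumes "x = u @ v @ w" and skip: "\<And>a z. a \<notin> T \<Longrightarrow> \<delta> q (Input a) z = Go q GoRight Keep"
    and hit: "\<And>a z. a \<in> T \<Longrightarrow> e = Dec \<longrightarrow> \<not> z \<Longrightarrow> \<delta> q (Input a) z = Go q GoRight e"
    and "c \<le> length x" "n = length (filter (\<lambda>a. a \<in> T) v)" "e = Inc \<Longrightarrow> c + n \<le> length x" "e = Dec \<Longrightarrow> n \<le> c"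
    and "p = Suc (length u)" "p' = Suc (length u + length v)" "c' = (count e ^^ n) c"
  shows "(counter_step \<delta> x)\<^sup>*\<^sup>* (q, p, c) (q, p', c')"
  unfolding assms(8-) using assms(1,4-7)
proof (induction v arbitrary: u c n)
  case Nil
  then show ?case by simp
next
  case (Cons a v)
  let ?e = "if a \<in> T then e else Keep"
  have "counter_step \<delta> x (q, Suc (length u), c) (q, Suc (length (u @ [a])), count ?e c)"
    using Cons.prems skip[of a] hit[of a] by (intro counter_stepI[where d = GoRight and a = ?e]) (cases e; auto)+
  moreover have "(counter_step \<delta> x)\<^sup>*\<^sup>* (q, Suc (length (u @ [a])), count ?e c)
      (q, Suc (length (u @ [a]) + length v),
        (count e ^^ length (filter (\<lambda>a. a \<in> T) v)) (count ?e c))"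
    using Cons.prems by (intro Cons.IH) (cases e; auto)+
  moreover have "(count e ^^ length (filter (\<lambda>a. a \<in> T) v)) (count ?e c) = (count e ^^ n) c"
    using Cons.prems(3) by (cases e) auto
  ultimately show ?case by simp
qed

text \<open>The mirrored pass. The head meets the last letter of \<open>v\<close> first, hence the
  reverse induction, and stops on the cell just before \<open>v\<close>.\<close>

lemma sweep_left:
  assumes "x = u @ v @ w" and skip: "\<And>a z. a \<notin> T \<Longrightarrow> \<delta> q (Input a) z = Go q GoLeft Keep"
    and hit: "\<And>a z. a \<in> T \<Longrightarrow> e = Dec \<longrightarrow> \<not> z \<Longrightarrow> \<delta> q (Input a) z = Go q GoLeft e"
    and "c \<le> length x" "n = length (filter (\<lambda>a. a \<in> T) v)" "e = Inc \<Longrightarrow> c + n \<le> length x" "e = Dec \<Longrightarrow> n \<le> c"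
    and "p = length u + length v" "p' = length u" "c' = (count e ^^ n) c"
  shows "(counter_step \<delta> x)\<^sup>*\<^sup>* (q, p, c) (q, p', c')"
  unfolding assms(8-) using assms(1,4-7)
proof (induction v arbitrary: w c n rule: rev_induct)
  case Nil
  then show ?case by simp
next
  case (snoc a v)
  let ?e = "if a \<in> T then e else Keep"
  have "input_at x (length u + length (v @ [a])) = Input a"
    using input_at_simps(2)[of "u @ v" a w] snoc.prems(1) by simp
  then have "counter_step \<delta> x (q, length u + length (v @ [a]), c) (q, length u + length v, count ?e c)"
    using snoc.prems skip[of a] hit[of a] by (intro counter_stepI[where d = GoLeft and a = ?e]) (cases e; auto)+
  moreover have "(counter_step \<delta> x)\<^sup>*\<^sup>* (q, length u + length v, count ?e c)
      (q, length u, (count e ^^ length (filter (\<lambda>a. a \<in> T) v)) (count ?e c))"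
    using snoc.prems by (intro snoc.IH[of "a # w"]) (cases e; auto)+
  moreover have "(count e ^^ length (filter (\<lambda>a. a \<in> T) v)) (count ?e c) = (count e ^^ n) c"
    using snoc.prems(3) by (cases e) auto
  ultimately show ?case by simp
qed

text \<open>Locates in \<open>x\<close> the letter at a given index of the subword, together with
  the numbers of track letters on both sides, which are what the counter measures.\<close>

lemma filter_nth_split:
  assumes "j < length (filter P x)"
  shows "\<exists>u v. x = u @ filter P x ! j # v \<and> P (filter P x ! j) \<and> length (filter P u) = j \<and>
    length (filter P v) = length (filter P x) - 1 - j"
  using assms
proof (induction x arbitrary: j)
  case (Cons a x)
  show ?case
  proof (cases "P a \<and> j = 0")
    case True
    then show ?thesis by (intro exI[of _ "[]"] exI[of _ x]) simp
  next
    case False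
    define i where "i = (if P a then j - 1 else j)"
    have "i < length (filter P x)" using False Cons.prems by (auto simp: i_def split: if_splits)
    from Cons.IH[OF this] obtain u v where
      *: "x = u @ filter P x ! i # v" "P (filter P x ! i)" "length (filter P u) = i"
        "length (filter P v) = length (filter P x) - 1 - i" by blast
    have nth: "filter P (a # x) ! j = filter P x ! i" using False by (auto simp: i_def nth_Cons')
    have "a # x = (a # u) @ filter P (a # x) ! j # v" unfolding nth using *(1) by simp
    moreover have "P (filter P (a # x) ! j)" unfolding nth by (rule *(2))
    moreover have "length (filter P (a # u)) = j" "length (filter P v) = length (filter P (a # x)) - 1 - j"
      using False *(3,4) by (auto simp: i_def)
    ultimately show ?thesis by blast
  qed
qed simp

section \<open>The machine for two palindromes\<close>

text \<open>The \<open>Drop\<close> modes count down to find a letter from the left or right end,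
  the \<open>Count\<close> modes rebuild the counter on the way back to that end, and the
  \<open>Go\<close> modes cross the input with the counter kept.\<close>

datatype mode = Drop_L | Count_L | Go_R | Drop_R | Count_R | Go_L

instance mode :: finite
proof
  have "a \<in> {Drop_L, Count_L, Go_R, Drop_R, Count_R, Go_L}" for a :: mode by (cases a) simp_all
  then show "finite (UNIV :: mode set)"
    by (intro finite_subset[of UNIV "{Drop_L, Count_L, Go_R, Drop_R, Count_R, Go_L}"] subsetI) simp_all
qed

text \<open>
  Started at the left end with counter \<open>j\<close>, the machine compares the letters of \<open>track k\<close> that have
  exactly \<open>j\<close> letters of that track to their left and to their right, respectively. It returns to the
  left end with counter \<open>j + 1\<close>. The second Boolean is the parity of the left letter, which determines
  it within the track.
\<close>

fun pal_delta :: "mode \<times> bool \<times> bool \<Rightarrow> nat insym \<Rightarrow> bool \<Rightarrow> (mode \<times> bool \<times> bool) action" where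
  "pal_delta (Drop_L, k, b) LeftEnd z = Go (Drop_L, k, b) GoRight Keep"
| "pal_delta (Drop_L, k, b) (Input a) z =
    (if a \<in> track k then if z then Go (Count_L, k, odd a) GoLeft Keep else Go (Drop_L, k, b) GoRight Dec
     else Go (Drop_L, k, b) GoRight Keep)"
| "pal_delta (Drop_L, k, b) RightEnd z = (if k then Go (Go_L, False, b) GoLeft Keep else Halt True)"
| "pal_delta (Count_L, k, b) LeftEnd z = Go (Go_R, k, b) GoRight Keep"
| "pal_delta (Count_L, k, b) (Input a) z = Go (Count_L, k, b) GoLeft (if a \<in> track k then Inc else Keep)"
| "pal_delta (Count_L, k, b) RightEnd z = Halt False"
| "pal_delta (Go_R, k, b) LeftEnd z = Halt False"
| "pal_delta (Go_R, k, b) (Input a) z = Go (Go_R, k, b) GoRight Keep"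
| "pal_delta (Go_R, k, b) RightEnd z = Go (Drop_R, k, b) GoLeft Keep"
| "pal_delta (Drop_R, k, b) LeftEnd z = Halt False"
| "pal_delta (Drop_R, k, b) (Input a) z =
    (if a \<in> track k then
       if z then if odd a = b then Go (Count_R, k, b) GoRight Inc else Halt False
       else Go (Drop_R, k, b) GoLeft Dec
     else Go (Drop_R, k, b) GoLeft Keep)"
| "pal_delta (Drop_R, k, b) RightEnd z = Halt False"
| "pal_delta (Count_R, k, b) LeftEnd z = Halt False"
| "pal_delta (Count_R, k, b) (Input a) z = Go (Count_R, k, b) GoRight (if a \<in> track k then Inc else Keep)"
| "pal_delta (Count_R, k, b) RightEnd z = Go (Go_L, k, b) GoLeft Keep"
| "pal_delta (Go_L, k, b) LeftEnd z = Go (Drop_L, k, b) GoRight Keep"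
| "pal_delta (Go_L, k, b) (Input a) z = Go (Go_L, k, b) GoLeft Keep"
| "pal_delta (Go_L, k, b) RightEnd z = Halt False"

interpretation palindrome_machine: counter_machine pal_delta "(Drop_L, True, False)" "{..<4}"
proof
  fix q q' :: "mode \<times> bool \<times> bool" and z e
  obtain m k b where "q = (m, k, b)" by (cases q)
  then show "pal_delta q LeftEnd z \<noteq> Go q' GoLeft e" "pal_delta q RightEnd z \<noteq> Go q' GoRight e"
    by (cases m; simp)+
qed simp

abbreviation reaches where
  "reaches x \<equiv> (counter_step pal_delta x)\<^sup>*\<^sup>*"

lemma reaches_compare:
  assumes x: "x = u @ a # v" "x = u' @ a' # v'" and "a \<in> track k"
    and j: "length (filter (\<lambda>a. a \<in> track k) u) = j" "length (filter (\<lambda>a. a \<in> track k) v') = j"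
  shows "reaches x ((Drop_L, k, b), 1, j) ((Drop_R, k, odd a), Suc (length u'), 0)"
proof -
  have jx: "j \<le> length x" using x(1) j(1) length_filter_le[of "\<lambda>a. a \<in> track k" u] by simp
  have "reaches x ((Drop_L, k, b), 1, j) ((Drop_L, k, b), Suc (length u), 0)"
    by (rule sweep_right[where u = "[]" and v = u and w = "a # v" and T = "track k" and e = Dec and n = j])
      (use x(1) j(1) jx in simp_all)
  also have "counter_step pal_delta x ((Drop_L, k, b), Suc (length u), 0) ((Count_L, k, odd a), length u, 0)"
    using assms(3) by (intro counter_stepI[where d = GoLeft and a = Keep]) (simp_all add: x(1))
  \<comment> \<open>The recount starts one cell left of \<open>a\<close>, so it covers exactly
    \<open>u\<close> and restores \<open>j\<close>.\<close>
  also have "reaches x ((Count_L, k, odd a), length u, 0) ((Count_L, k, odd a), 0, j)"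
    by (rule sweep_left[where u = "[]" and v = u and w = "a # v" and T = "track k" and e = Inc and n = j])
      (use x(1) j(1) jx in simp_all)
  also have "counter_step pal_delta x ((Count_L, k, odd a), 0, j) ((Go_R, k, odd a), 1, j)"
    by (intro counter_stepI[where d = GoRight and a = Keep]) (simp_all add: jx)
  also have "reaches x ((Go_R, k, odd a), 1, j) ((Go_R, k, odd a), Suc (length x), j)"
    by (rule sweep_right[where u = "[]" and v = x and w = "[]" and T = "track k" and e = Keep])
      (use jx in simp_all)
  also have "counter_step pal_delta x ((Go_R, k, odd a), Suc (length x), j) ((Drop_R, k, odd a), length x, j)"
    by (intro counter_stepI[where d = GoLeft and a = Keep]) (simp_all add: jx)
  also have "reaches x ((Drop_R, k, odd a), length x, j) ((Drop_R, k, odd a), Suc (length u'), 0)"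
    by (rule sweep_left[where u = "u' @ [a']" and v = v' and w = "[]" and T = "track k" and e = Dec and n = j])
      (use x(2) j(2) jx in simp_all)
  finally show ?thesis .
qed

lemma reaches_next:
  assumes x: "x = u' @ a' # v'" and "a' \<in> track k" "odd a' = b"
    and j: "length (filter (\<lambda>a. a \<in> track k) v') = j"
  shows "reaches x ((Drop_R, k, b), Suc (length u'), 0) ((Drop_L, k, b), 1, Suc j)"
proof -
  have jx: "Suc j \<le> length x" using x j length_filter_le[of "\<lambda>a. a \<in> track k" v'] by simp
  \<comment> \<open>The comparing step already counts the right letter; the \<open>j\<close> track
    letters of \<open>v'\<close> then bring the counter to \<open>Suc j\<close>.\<close>
  have "counter_step pal_delta x ((Drop_R, k, b), Suc (length u'), 0) ((Count_R, k, b), Suc (length (u' @ [a'])), 1)"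
    using assms(2,3) by (intro counter_stepI[where d = GoRight and a = Inc]) (simp_all add: x)
  also have "reaches x ((Count_R, k, b), Suc (length (u' @ [a'])), 1) ((Count_R, k, b), Suc (length x), Suc j)"
    by (rule sweep_right[where u = "u' @ [a']" and v = v' and w = "[]" and T = "track k" and e = Inc and n = j])
      (use x j jx in simp_all)
  also have "counter_step pal_delta x ((Count_R, k, b), Suc (length x), Suc j) ((Go_L, k, b), length x, Suc j)"
    by (intro counter_stepI[where d = GoLeft and a = Keep]) (simp_all add: jx)
  also have "reaches x ((Go_L, k, b), length x, Suc j) ((Go_L, k, b), 0, Suc j)"
    by (rule sweep_left[where u = "[]" and v = x and w = "[]" and T = "track k" and e = Keep])
      (use jx in simp_all)
  also have "counter_step pal_delta x ((Go_L, k, b), 0, Suc j) ((Drop_L, k, b), 1, Suc j)"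
    by (intro counter_stepI[where d = GoRight and a = Keep]) (simp_all add: jx)
  finally show ?thesis .
qed

text \<open>Induction on the number of subword letters not yet compared. If all have agreed,
  dropping \<open>length f\<close> letters arrives at the right end with counter 0; the first
  disagreement halts with rejection.\<close>

lemma reaches_track:
  fixes x k
  defines "f \<equiv> filter (\<lambda>a. a \<in> track k) x"
  assumes "j \<le> length f" "\<And>i. i < j \<Longrightarrow> f ! i = rev f ! i"
  shows "(rev f = f \<longrightarrow> (\<exists>b'. reaches x ((Drop_L, k, b), 1, j) ((Drop_L, k, b'), Suc (length x), 0))) \<and>
    (rev f \<noteq> f \<longrightarrow> (\<exists>q p c. reaches x ((Drop_L, k, b), 1, j) (q, p, c) \<and>
      pal_delta q (input_at x p) (c = 0) = Halt False))"
  using assms(2,3)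
proof (induction "length f - j" arbitrary: j b)
  case 0
  then have j: "j = length f" by simp
  then have pal: "rev f = f" using 0 by (intro nth_equalityI) auto
  have jx: "j \<le> length x" using j by (simp add: f_def)
  have "reaches x ((Drop_L, k, b), 1, j) ((Drop_L, k, b), Suc (length x), 0)"
    by (rule sweep_right[where u = "[]" and v = x and w = "[]" and T = "track k" and e = Dec and n = j])
      (use j jx f_def in simp_all)
  then show ?case using pal by auto
next
  case (Suc n)
  \<comment> \<open>Index of the subword letter that has exactly \<open>j\<close> track letters to
    its right.\<close>
  define i where "i = length f - 1 - j"
  have less: "j < length f" "i < length f" using Suc(2) by (simp_all add: i_def)
  obtain u v where uv: "x = u @ f ! j # v" "f ! j \<in> track k" "length (filter (\<lambda>a. a \<in> track k) u) = j"
    using filter_nth_split[of j "\<lambda>a. a \<in> track k" x] less(1) unfolding f_def by blast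
  obtain u' v' where uv': "x = u' @ f ! i # v'" "f ! i \<in> track k" "length (filter (\<lambda>a. a \<in> track k) v') = j"
    using filter_nth_split[of i "\<lambda>a. a \<in> track k" x] less(2) Suc(2) unfolding f_def i_def by fastforce
  have rev: "rev f ! j = f ! i" using less by (simp add: rev_nth i_def)
  note cmp = reaches_compare[OF uv(1) uv'(1) uv(2,3) uv'(3), of b]
  show ?case
  proof (cases "f ! j = f ! i")
    case True
    have "reaches x ((Drop_L, k, b), 1, j) ((Drop_L, k, odd (f ! j)), 1, Suc j)"
      using rtranclp_trans[OF cmp reaches_next[OF uv'(1,2) _ uv'(3)]] True by simp
    note 1 = rtranclp_trans[OF this]
    have agree: "f ! i = rev f ! i" if "i < Suc j" for i using that Suc.prems(2) True rev by (metis less_Suc_eq)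
    have IH: "(rev f = f \<longrightarrow> (\<exists>b'. reaches x ((Drop_L, k, odd (f ! j)), 1, Suc j) ((Drop_L, k, b'), Suc (length x), 0))) \<and>
      (rev f \<noteq> f \<longrightarrow> (\<exists>q p c. reaches x ((Drop_L, k, odd (f ! j)), 1, Suc j) (q, p, c) \<and>
        pal_delta q (input_at x p) (c = 0) = Halt False))"
      by (rule Suc.hyps(1)) (use Suc.hyps(2) less agree in auto)
    show ?thesis
    proof (intro conjI impI)
      assume "rev f = f"
      from IH[THEN conjunct1, rule_format, OF this] obtain b' where "reaches x ((Drop_L, k, odd (f ! j)), 1, Suc j) ((Drop_L, k, b'), Suc (length x), 0)"
        by (elim exE)
      from 1[OF this] show "\<exists>b'. reaches x ((Drop_L, k, b), 1, j) ((Drop_L, k, b'), Suc (length x), 0)" ..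
    next
      assume "rev f \<noteq> f"
      from IH[THEN conjunct2, rule_format, OF this] obtain q p c where "reaches x ((Drop_L, k, odd (f ! j)), 1, Suc j) (q, p, c)"
        "pal_delta q (input_at x p) (c = 0) = Halt False"
        by (elim exE conjE)
      with 1[OF this(1)] show "\<exists>q p c. reaches x ((Drop_L, k, b), 1, j) (q, p, c) \<and>
        pal_delta q (input_at x p) (c = 0) = Halt False" by (intro exI conjI)
    qed
  next
    case False
    \<comment> \<open>Two different letters of the same track differ in parity, so one Boolean of
      memory detects the mismatch.\<close>
    then have "odd (f ! j) \<noteq> odd (f ! i)" using uv(2) uv'(2) by (auto simp: track_def split: if_splits)
    then have halt: "pal_delta (Drop_R, k, odd (f ! j)) (input_at x (Suc (length u'))) (0 = (0::nat)) = Halt False"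
      using uv'(2) input_at_simps(2)[of u' "f ! i" v', folded uv'(1)] by simp
    have no_pal: "rev f \<noteq> f" using False rev by metis
    have "\<exists>q p c. reaches x ((Drop_L, k, b), 1, j) (q, p, c) \<and> pal_delta q (input_at x p) (c = 0) = Halt False"
      by (rule exI, rule exI, rule exI, rule conjI[OF cmp halt])
    with no_pal show ?thesis by blast
  qed
qed

lemma reaches_track_palindrome:
  assumes "rev (filter (\<lambda>a. a \<in> track k) x) = filter (\<lambda>a. a \<in> track k) x"
  obtains b' where "reaches x ((Drop_L, k, b), 1, 0) ((Drop_L, k, b'), Suc (length x), 0)"
proof -
  have "\<exists>b'. reaches x ((Drop_L, k, b), 1, 0) ((Drop_L, k, b'), Suc (length x), 0)"
    by (rule reaches_track[of 0 k x b, OF le0, THEN conjunct1, rule_format, OF _ assms]) simp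
  then show thesis using that by (elim exE)
qed

lemma reaches_track_no_palindrome:
  assumes "rev (filter (\<lambda>a. a \<in> track k) x) \<noteq> filter (\<lambda>a. a \<in> track k) x"
  obtains q p c where "reaches x ((Drop_L, k, b), 1, 0) (q, p, c)"
    "pal_delta q (input_at x p) (c = 0) = Halt False"
proof -
  have "\<exists>q p c. reaches x ((Drop_L, k, b), 1, 0) (q, p, c) \<and> pal_delta q (input_at x p) (c = 0) = Halt False"
    by (rule reaches_track[of 0 k x b, OF le0, THEN conjunct2, rule_format, OF _ assms]) simp
  then show thesis using that by (elim exE conjE)
qed

theorem two_palindromes_LOGSPACE: "two_palindromes \<in> LOGSPACE"
proof (rule palindrome_machine.LOGSPACE_if_decides)
  show "two_palindromes \<subseteq> lists {..<4}" unfolding two_palindromes_def by blast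
  fix x :: "nat list" assume x: "x \<in> lists {..<4}"
  let ?f = "\<lambda>k. filter (\<lambda>a. a \<in> track k) x"
  have mem: "x \<in> two_palindromes \<longleftrightarrow> rev (?f True) = ?f True \<and> rev (?f False) = ?f False"
    using x by (simp add: two_palindromes_def all_bool_eq conj_commute)
  have start: "reaches x ((Drop_L, True, False), 0, 0) ((Drop_L, True, False), 1, 0)"
    by (intro r_into_rtranclp counter_stepI[where d = GoRight and a = Keep]) simp_all
  show "\<exists>q p c. reaches x ((Drop_L, True, False), 0, 0) (q, p, c) \<and>
    pal_delta q (input_at x p) (c = 0) = Halt (x \<in> two_palindromes)"
  proof (cases "rev (?f True) = ?f True")
    case False
    then obtain q p c where "reaches x ((Drop_L, True, False), 1, 0) (q, p, c)"
      "pal_delta q (input_at x p) (c = 0) = Halt False"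
      by (rule reaches_track_no_palindrome[where b = False])
    with rtranclp_trans[OF start this(1)] show ?thesis using False mem by (intro exI conjI) auto
  next
    case True
    then obtain b where first: "reaches x ((Drop_L, True, False), 1, 0) ((Drop_L, True, b), Suc (length x), 0)"
      by (rule reaches_track_palindrome[where b = False])
    note start
    also note first
    \<comment> \<open>At the right end the first track is done and the counter is 0, as the round on
      the second track requires.\<close>
    also have "counter_step pal_delta x ((Drop_L, True, b), Suc (length x), 0) ((Go_L, False, b), length x, 0)"
      by (intro counter_stepI[where d = GoLeft and a = Keep]) simp_all
    also have "reaches x ((Go_L, False, b), length x, 0) ((Go_L, False, b), 0, 0)"
      by (rule sweep_left[where u = "[]" and v = x and w = "[]" and T = "track False" and e = Keep])
      (simp_all)
    also have "counter_step pal_delta x ((Go_L, False, b), 0, 0) ((Drop_L, False, b), 1, 0)"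
      by (intro counter_stepI[where d = GoRight and a = Keep]) simp_all
    finally have second: "reaches x ((Drop_L, True, False), 0, 0) ((Drop_L, False, b), 1, 0)" .
    show ?thesis
    proof (cases "rev (?f False) = ?f False")
      case False
      then obtain q p c where "reaches x ((Drop_L, False, b), 1, 0) (q, p, c)"
        "pal_delta q (input_at x p) (c = 0) = Halt False"
        by (rule reaches_track_no_palindrome[where b = b])
      with rtranclp_trans[OF second this(1)] show ?thesis using False mem by (intro exI conjI) auto
    next
      case pal: True
      then obtain b' where "reaches x ((Drop_L, False, b), 1, 0) ((Drop_L, False, b'), Suc (length x), 0)"
        by (rule reaches_track_palindrome[where b = b])
      with second have "reaches x ((Drop_L, True, False), 0, 0) ((Drop_L, False, b'), Suc (length x), 0)"
        by (rule rtranclp_trans)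
      moreover have "pal_delta (Drop_L, False, b') (input_at x (Suc (length x))) (0 = (0::nat)) =
          Halt (x \<in> two_palindromes)" using mem True pal by simp
      ultimately show ?thesis by (intro exI conjI)
    qed
  qed
qed

section \<open>Separation\<close>

text \<open>Stated up to an injective renaming of letters: the identity gives the language itself,
  and \<open>a \<mapsto> (a, 0)\<close> gives its version with constant advice.\<close>

theorem two_palindromes_CFL2:
  assumes "inj f"
  shows "{w \<in> lists (f ` {..<4}). \<forall>k. rev (filter (\<lambda>a. a \<in> f ` track k) w) = filter (\<lambda>a. a \<in> f ` track k) w}
    \<in> CFL2" (is "?L \<in> CFL2")
proof -
  let ?A = "\<lambda>k. {w \<in> lists (f ` {..<4}). rev (filter (\<lambda>a. a \<in> f ` track k) w) = filter (\<lambda>a. a \<in> f ` track k) w}"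
  have CFL: "?A k \<in> CFL" for k
  proof -
    have "f ` track k \<inter> f ` track (\<not> k) = {}"
      using assms by (auto simp: track_def inj_eq split: if_splits)
    moreover have "finite (f ` track k')" for k' by (simp add: track_def)
    ultimately show ?thesis
      unfolding lessThan_4[of k] image_Un by (intro filter_palindrome_CFL)
  qed
  have "?L = ?A True \<inter> ?A False" by (auto simp: all_bool_eq)
  then show ?thesis unfolding CFL2_def mem_Collect_eq using CFL by (intro exI conjI)
qed

lemma with_adviceI:
  assumes "finite \<Sigma>" "L \<subseteq> lists \<Sigma>" "finite \<Gamma>" "\<And>n. h n \<in> lists \<Gamma>" "\<And>n. length (h n) = n"
    "S \<in> \<C>" "S \<subseteq> lists (\<Sigma> \<times> \<Gamma>)" "\<And>x. x \<in> lists \<Sigma> \<Longrightarrow> x \<in> L \<longleftrightarrow> zip x (h (length x)) \<in> S"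
  shows "L \<in> with_advice \<C>"
  unfolding with_advice_def mem_Collect_eq
  by (rule exI[of _ \<Sigma>], rule exI[of _ \<Gamma>], rule exI[of _ h], rule exI[of _ S]) (use assms in simp)

text \<open>Advice consisting of zeros carries no information and only renames each letter.\<close>

lemma two_palindromes_advised_CFL2: "two_palindromes \<in> with_advice CFL2"
proof -
  let ?f = "\<lambda>a::nat. (a, 0::nat)"
  let ?S = "{w \<in> lists (?f ` {..<4}). \<forall>k. rev (filter (\<lambda>a. a \<in> ?f ` track k) w) = filter (\<lambda>a. a \<in> ?f ` track k) w}"
  have inj: "inj ?f" by (simp add: inj_def)
  have zip: "zip x (replicate (length x) 0) = map ?f x" for x by (induction x) auto
  have "x \<in> two_palindromes \<longleftrightarrow> map ?f x \<in> ?S" for x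
  proof -
    have "filter (\<lambda>a. a \<in> ?f ` track k) (map ?f x) = map ?f (filter (\<lambda>a. a \<in> track k) x)" for k
      by (simp add: filter_map comp_def image_iff)
    moreover have "map ?f x \<in> lists (?f ` {..<4}) \<longleftrightarrow> x \<in> lists {..<4}" by auto
    ultimately show ?thesis
      using inj by (simp add: two_palindromes_def rev_map inj_map_eq_map)
  qed
  then have "x \<in> two_palindromes \<longleftrightarrow> zip x (replicate (length x) 0) \<in> ?S" for x
    by (simp only: zip)
  moreover have "two_palindromes \<subseteq> lists {..<4}" unfolding two_palindromes_def by blast
  moreover have "?S \<subseteq> lists ({..<4} \<times> {0})" by auto
  ultimately show ?thesis
    by (intro with_adviceI[of "{..<4}" _ "{0}" "\<lambda>n. replicate n 0" ?S] two_palindromes_CFL2[OF inj]) auto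
qed

theorem corollary3p10:
  "\<not> (LOGSPACE \<inter> with_advice CFL2 \<subseteq> (with_advice CFL :: nat list set set)) \<and>
   \<not> (CFL2 \<subseteq> (with_advice CFL :: nat list set set))"
proof -
  have "two_palindromes \<in> CFL2"
    using two_palindromes_CFL2[of id] by (simp add: two_palindromes_def)
  then show ?thesis
    using two_palindromes_LOGSPACE two_palindromes_advised_CFL2 two_palindromes_not_advised_CFL by blast
qed

end
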